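(* The synchronization problem $\textsc{Synchro}$ for rendez-vous protocols is undecidable, and it remains undecidable when restricted to wait-only protocols.
   Context: A rendez-vous protocol is a tuple $\mathcal P=(Q,\Sigma,q_{in},q_f,T)$ with $Q$ a finite set of states, $\Sigma$ a finite alphabet, $q_{in},q_f\in Q$, and $T\subseteq Q\times(\{\tau\}\cup\{?m,!m\mid m\in\Sigma\})\times Q$ finite. It is wait-only if $Q$ can be partitioned into active states $Q_A$ and waiting states $Q_W$ with $q_{in}\in Q_A$ such that no transition $(q,?m,q')$ has $q\in Q_A$, and no transition $(q,!m,q')$ or $(q,\tau,q')$ has $q\in Q_W$. A configuration is a non-empty multiset $C$ over $Q$; it is initial if $C(q)=0$ for all $q\neq q_{in}$. $\langle q_1,q_2\rangle$ denotes a multiset. The (non-blocking) semantics: $C\to C'$ iff one of: (internal) there is $(q,\tau,q')\in T$ with $C(q)>0$ and $C'=C-\langle q\rangle+\langle q'\rangle$; (rendez-vous) there are $(q_1,!m,q_1'),(q_2,?m,q_2')\in T$ with $C(q_1)>0$, $C(q_2)>0$, $C(q_1)+C(q_2)\ge2$ and $C'=C-\langle q_1,q_2\rangle+\langle q_1',q_2'\rangle$; (non-blocking request) there is $(q_1,!m,q_1')\in T$ with $C(q_1)>0$, $(C-\langle q_1\rangle)(q_2)=0$ for all $(q_2,?m,q_2')\in T$, and $C'=C-\langle q_1\rangle+\langle q_1'\rangle$. $\textsc{Synchro}$: given $\mathcal P$, decide whether there exist an initial $C_0$ and a configuration $C_f$ with $C_f(q)=0$ for all $q\neq q_f$ and $C_0\to^*C_f$.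 *)

theory Defs
  imports "HOL-Library.Multiset" "HOL-Library.Nat_Bijection"
begin

section \<open>Rendez-vous protocols\<close>

datatype 'm action = Tau | Send 'm | Recv 'm

record ('q, 'm) protocol =
  states :: "'q set"
  alphabet :: "'m set"
  q_init :: 'q
  q_final :: 'q
  trans :: "('q \<times> 'm action \<times> 'q) set"

definition is_protocol :: "('q, 'm) protocol \<Rightarrow> bool" where
  "is_protocol P \<longleftrightarrow>
     finite (states P) \<and> finite (alphabet P) \<and>
     q_init P \<in> states P \<and> q_final P \<in> states P \<and>
     trans P \<subseteq> states P \<times> ({Tau} \<union> Recv ` alphabet P \<union> Send ` alphabet P) \<times> states P"

definition wait_only :: "('q, 'm) protocol \<Rightarrow> bool" where
  "wait_only P \<longleftrightarrow>
     (\<exists>QA QW. QA \<union> QW = states P \<and> QA \<inter> QW = {} \<and> q_init P \<in> QA \<and>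
        (\<forall>q m q'. (q, Recv m, q') \<in> trans P \<longrightarrow> q \<notin> QA) \<and>
        (\<forall>q m q'. (q, Send m, q') \<in> trans P \<longrightarrow> q \<notin> QW) \<and>
        (\<forall>q q'. (q, Tau, q') \<in> trans P \<longrightarrow> q \<notin> QW))"

definition configuration :: "('q, 'm) protocol \<Rightarrow> 'q multiset \<Rightarrow> bool" where
  "configuration P C \<longleftrightarrow> C \<noteq> {#} \<and> set_mset C \<subseteq> states P"

definition initial_configuration :: "('q, 'm) protocol \<Rightarrow> 'q multiset \<Rightarrow> bool" where
  "initial_configuration P C \<longleftrightarrow> configuration P C \<and> (\<forall>q. q \<noteq> q_init P \<longrightarrow> count C q = 0)"

definition final_configuration :: "('q, 'm) protocol \<Rightarrow> 'q multiset \<Rightarrow> bool" where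
  "final_configuration P C \<longleftrightarrow> configuration P C \<and> (\<forall>q. q \<noteq> q_final P \<longrightarrow> count C q = 0)"

text \<open>
  In a rendez-vous the sender and the receiver are two distinct processes. The premise
  \<^prop>\<open>{#q1, q2#} \<subseteq># C\<close> says that the multiset \<open>C - {#q1, q2#}\<close> is a genuine (not truncated)
  difference; for \<open>q1 \<noteq> q2\<close> it just says that both states are occupied, for \<open>q1 = q2\<close>
  it asks for two processes in that state.
\<close>
inductive step :: "('q, 'm) protocol \<Rightarrow> 'q multiset \<Rightarrow> 'q multiset \<Rightarrow> bool"
  for P :: "('q, 'm) protocol" where
  internal:
    "(q, Tau, q') \<in> trans P \<Longrightarrow> count C q > 0 \<Longrightarrow>
     step P C (C - {#q#} + {#q'#})"
| rendez_vous:
    "(q1, Send m, q1') \<in> trans P \<Longrightarrow> (q2, Recv m, q2') \<in> trans P \<Longrightarrow>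
     {#q1, q2#} \<subseteq># C \<Longrightarrow>
     step P C (C - {#q1, q2#} + {#q1', q2'#})"
| non_blocking_request:
    "(q1, Send m, q1') \<in> trans P \<Longrightarrow> count C q1 > 0 \<Longrightarrow>
     (\<And>q2 q2'. (q2, Recv m, q2') \<in> trans P \<Longrightarrow> count (C - {#q1#}) q2 = 0) \<Longrightarrow>
     step P C (C - {#q1#} + {#q1'#})"

definition synchro :: "('q, 'm) protocol \<Rightarrow> bool" where
  "synchro P \<longleftrightarrow>
     (\<exists>C0 Cf. initial_configuration P C0 \<and> final_configuration P Cf \<and> (step P)\<^sup>*\<^sup>* C0 Cf)"


section \<open>Partial recursive functions and decidability\<close>

datatype recf =
    Zero
  | Succ
  | Proj nat
  | Comp recf "recf list"
  | PrimRec recf recf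
  | Mu recf

text \<open>
  \<open>computes f xs y\<close>: the partial function denoted by \<open>f\<close> is defined on the argument tuple
  \<open>xs\<close> with value \<open>y\<close>. Recursion and minimisation act on the first argument.
\<close>
inductive computes :: "recf \<Rightarrow> nat list \<Rightarrow> nat \<Rightarrow> bool" where
  Zero: "computes Zero xs 0"
| Succ: "computes Succ [x] (Suc x)"
| Proj: "i < length xs \<Longrightarrow> computes (Proj i) xs (xs ! i)"
| Comp: "list_all2 (\<lambda>g y. computes g xs y) gs ys \<Longrightarrow> computes f ys z \<Longrightarrow>
         computes (Comp f gs) xs z"
| PrimRec_0: "computes f xs y \<Longrightarrow> computes (PrimRec f g) (0 # xs) y"
| PrimRec_Suc: "computes (PrimRec f g) (n # xs) y \<Longrightarrow> computes g (n # y # xs) z \<Longrightarrow>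
         computes (PrimRec f g) (Suc n # xs) z"
| Mu: "computes f (n # xs) 0 \<Longrightarrow> (\<And>k. k < n \<Longrightarrow> \<exists>y. y \<noteq> 0 \<and> computes f (k # xs) y) \<Longrightarrow>
         computes (Mu f) xs n"

lemma computes_deterministic:
  "computes f xs y \<Longrightarrow> computes f xs z \<Longrightarrow> y = z"
proof (induction arbitrary: z rule: computes.induct)
  case (Comp xs gs ys f z z')
  from Comp.prems obtain ys' where ys': "list_all2 (\<lambda>g y. computes g xs y) gs ys'"
    and z': "computes f ys' z'"
    by cases blast
  have "ys = ys'"
    using Comp.IH(1) ys' by (auto simp: list_all2_conv_all_nth intro!: nth_equalityI)
  with Comp.IH(2) z' show ?case by blast
next
  case (PrimRec_Suc f g n xs y z z')
  from PrimRec_Suc.prems obtain y' where "computes (PrimRec f g) (n # xs) y'"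
    "computes g (n # y' # xs) z'"
    by cases blast
  with PrimRec_Suc.IH show ?case by blast
next
  case (PrimRec_0 f xs y g z)
  from PrimRec_0.prems have "computes f xs z" by cases blast
  with PrimRec_0.IH show ?case by blast
next
  case (Mu f n xs z)
  from Mu.prems have z: "computes f (z # xs) 0"
    and lt: "\<And>k. k < z \<Longrightarrow> \<exists>y. y \<noteq> 0 \<and> computes f (k # xs) y"
    by (cases, blast)+
  have "\<not> n < z"
    using Mu.IH(1) lt by metis
  moreover have "\<not> z < n"
    using Mu.IH(2) z by metis
  ultimately show ?case by simp
next
  case (Zero xs)
  then show ?case by cases simp
next
  case (Succ x)
  then show ?case by cases simp
next
  case (Proj i xs)
  from Proj.prems show ?case by cases simp
qed

text \<open>
  A decision problem consists of a set \<open>I\<close> of instances, a coding of the instances by natural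
  numbers and the property \<open>A\<close> to be decided. The algorithm has to halt with the correct
  answer on all codes of instances; on other numbers it may behave arbitrarily.
\<close>
definition decidable :: "('a \<Rightarrow> nat) \<Rightarrow> 'a set \<Rightarrow> ('a \<Rightarrow> bool) \<Rightarrow> bool" where
  "decidable code I A \<longleftrightarrow> (\<exists>f. \<forall>x\<in>I. computes f [code x] (if A x then 1 else 0))"


section \<open>Protocols as inputs of algorithms\<close>

text \<open>
  As inputs, protocols have natural numbers as names of states and messages, which covers all
  protocols up to renaming. Finite sets are coded by their characteristic bit pattern
  (\<^const>\<open>set_encode\<close>).
\<close>
fun action_code :: "nat action \<Rightarrow> nat" where
  "action_code Tau = 0"
| "action_code (Send m) = 2 * m + 1"
| "action_code (Recv m) = 2 * m + 2"

definition transition_code :: "nat \<times> nat action \<times> nat \<Rightarrow> nat" where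
  "transition_code = (\<lambda>(q, a, q'). prod_encode (q, prod_encode (action_code a, q')))"

definition protocol_code :: "(nat, nat) protocol \<Rightarrow> nat" where
  "protocol_code P =
     prod_encode (set_encode (states P),
     prod_encode (set_encode (alphabet P),
     prod_encode (q_init P,
     prod_encode (q_final P,
       set_encode (transition_code ` trans P)))))"

lemma action_code_eq_iff [simp]: "action_code a = action_code b \<longleftrightarrow> a = b"
  by (cases a; cases b) (auto, presburger+)

lemma inj_transition_code: "inj transition_code"
  by (auto simp: inj_def transition_code_def)

lemma is_protocol_finite_trans: "is_protocol P \<Longrightarrow> finite (trans P)"
  unfolding is_protocol_def by (auto elim!: finite_subset)

lemma inj_on_protocol_code: "inj_on protocol_code {P. is_protocol P}"
proof (rule inj_onI)
  fix P P' :: "(nat, nat) protocol"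
  assume "P \<in> {P. is_protocol P}" "P' \<in> {P. is_protocol P}"
    and eq: "protocol_code P = protocol_code P'"
  then have P: "is_protocol P" and P': "is_protocol P'" by auto
  have "transition_code ` trans P = transition_code ` trans P'"
    using eq P P' by (auto simp: protocol_code_def is_protocol_finite_trans set_encode_eq)
  then have "trans P = trans P'"
    by (simp add: inj_image_eq_iff[OF inj_transition_code])
  with eq P P' show "P = P'"
    by (auto simp: protocol_code_def is_protocol_def set_encode_eq)
qed

end

theory Submission
  imports Defs
begin

text \<open>
  A recursive function \<open>f\<close> becomes a nondeterministic counter machine, and a counter machine
  becomes a wait-only protocol. One process is elected leader and follows the control flow; the
  number of processes in state \<open>Token i\<close> is the value of counter \<open>i\<close>. A zero test is a request
  that turns a token into an inescapable sink if there is one. Since requests are non-blocking,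
  the leader waits for an acknowledgement after each increment or decrement: it is stuck for ever
  if nobody received the request. Synchronization then amounts to an accepting run.

  The diagonal argument needs no universal machine. Let \<open>n\<close> code the transition set of the
  protocol that accepts \<open>x\<close> iff \<open>f x = 0\<close>; prefixing it by a chain of states that loads \<open>n\<close>
  into counter 0 yields a protocol whose code is a primitive recursive function of \<open>n\<close>. If \<open>f\<close>
  computes the answer of a decision procedure on that code, the protocol synchronizes iff the
  procedure denies it.
\<close>

section \<open>Recursive functions\<close>

text \<open>The obstacle is self-reference: the machine has to work on the code of a protocol that
  contains it. Only the loader depends on the number \<open>n\<close>, and this breaks the circle.
  The function \<open>c\<close> computing \<open>loaded_code\<close> is uniform in \<open>n\<close>,
  so the edges \<open>E\<close> for \<open>Comp d [c]\<close> are fixed first, the register bound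
  \<open>r\<close> is read off from \<open>E\<close>, and only then \<open>n\<close> is defined as
  the code of the transitions given by \<open>r\<close> and \<open>E\<close>. Bit patterns of
  disjoint sets add up, so completing \<open>n\<close> to the code of the whole protocol is plain
  arithmetic with bounded sums; neither a fixed point theorem nor a program that manipulates
  programs is involved. Synchronization is existential, so unfaithful runs do no harm unless they
  end with all processes in \<open>Final\<close>. Its choice of the population size also pays for
  unbounded counters: a suitable initial configuration supplies exactly one idle process per
  increment of the accepting run. The acceptor clears its counters because each remaining token
  would be a process outside \<open>Final\<close>.\<close>

definition rec_fn :: "nat \<Rightarrow> (nat list \<Rightarrow> nat) \<Rightarrow> bool" where
  "rec_fn n h \<longleftrightarrow> (\<exists>r. \<forall>xs. length xs = n \<longrightarrow> computes r xs (h xs))"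

lemma rec_fn_cong: "rec_fn n h \<Longrightarrow> (\<And>xs. length xs = n \<Longrightarrow> h xs = h' xs) \<Longrightarrow> rec_fn n h'"
  unfolding rec_fn_def by auto

lemma rec_fn_proj: "i < n \<Longrightarrow> rec_fn n (\<lambda>xs. xs ! i)"
  unfolding rec_fn_def by (metis computes.Proj)

lemma rec_fn_comp:
  assumes "rec_fn (length hs) h" and "\<forall>g\<in>set hs. rec_fn n g"
  shows "rec_fn n (\<lambda>xs. h (map (\<lambda>g. g xs) hs))"
proof -
  obtain r where r: "\<And>xs. length xs = length hs \<Longrightarrow> computes r xs (h xs)"
    using assms(1) unfolding rec_fn_def by blast
  obtain R where R: "\<And>g xs. g \<in> set hs \<Longrightarrow> length xs = n \<Longrightarrow> computes (R g) xs (g xs)"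
    using assms(2) unfolding rec_fn_def by metis
  have "computes (Comp r (map R hs)) xs (h (map (\<lambda>g. g xs) hs))" if "length xs = n" for xs
    by (rule computes.Comp[where ys = "map (\<lambda>g. g xs) hs"])
      (auto simp: list_all2_conv_all_nth R r that)
  then show ?thesis unfolding rec_fn_def by blast
qed

lemma rec_fn_const: "rec_fn n (\<lambda>xs. c)"
proof (induction c)
  case 0
  show ?case unfolding rec_fn_def by (metis computes.Zero)
next
  case (Suc c)
  have "rec_fn (length [\<lambda>xs :: nat list. c]) (\<lambda>xs. Suc (hd xs))"
    unfolding rec_fn_def by (rule exI[of _ Succ]) (auto simp: length_Suc_conv computes.Succ)
  from rec_fn_comp[OF this, of n] Suc show ?case by simp
qed

text \<open>\<open>PrimRec\<close> recurses on its first argument. Composition with \<open>a\<close>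
  and all projections turns the bound into an arbitrary function of the parameters;
  \<open>map_nth\<close> then reassembles the parameter tuple.\<close>

lemma rec_fn_rec_nat:
  assumes f: "rec_fn n f" and g: "rec_fn (Suc (Suc n)) g" and a: "rec_fn n a"
  shows "rec_fn n (\<lambda>xs. rec_nat (f xs) (\<lambda>k y. g (k # y # xs)) (a xs))"
proof -
  obtain rf rg where rf: "\<And>xs. length xs = n \<Longrightarrow> computes rf xs (f xs)"
    and rg: "\<And>xs. length xs = Suc (Suc n) \<Longrightarrow> computes rg xs (g xs)"
    using f g unfolding rec_fn_def by blast
  have "computes (PrimRec rf rg) (k # xs) (rec_nat (f xs) (\<lambda>k y. g (k # y # xs)) k)"
    if "length xs = n" for k xs
  proof (induction k)
    case 0
    show ?case using rf[OF that] by (simp add: computes.PrimRec_0)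
  next
    case (Suc k)
    from computes.PrimRec_Suc[OF this rg] that show ?case by simp
  qed
  then have "rec_fn (Suc n) (\<lambda>ys. rec_nat (f (tl ys)) (\<lambda>k y. g (k # y # tl ys)) (hd ys))"
    unfolding rec_fn_def by (intro exI[of _ "PrimRec rf rg"]) (auto simp: length_Suc_conv)
  then have *: "rec_fn (length (a # map (\<lambda>i xs. xs ! i) [0..<n]))
      (\<lambda>ys. rec_nat (f (tl ys)) (\<lambda>k y. g (k # y # tl ys)) (hd ys))"
    by simp
  have "rec_fn n (\<lambda>xs. rec_nat (f (map ((!) xs) [0..<n]))
      (\<lambda>k y. g (k # y # map ((!) xs) [0..<n])) (a xs))"
    using rec_fn_comp[OF *, of n] a by (auto simp: rec_fn_proj comp_def)
  then show ?thesis
    by (rule rec_fn_cong) (metis map_nth)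
qed

section \<open>Arithmetic and pairing\<close>

lemma rec_fn_add:
  assumes "rec_fn n a" "rec_fn n b"
  shows "rec_fn n (\<lambda>xs. a xs + b xs)"
proof -
  have "rec_fn (length [\<lambda>ys :: nat list. ys ! 1]) (\<lambda>xs. Suc (hd xs))"
    unfolding rec_fn_def by (rule exI[of _ Succ]) (auto simp: length_Suc_conv computes.Succ)
  from rec_fn_comp[OF this, of "Suc (Suc n)"] have "rec_fn (Suc (Suc n)) (\<lambda>ys. Suc (ys ! 1))"
    by (simp add: rec_fn_proj)
  from rec_fn_rec_nat[OF assms(1) this assms(2)]
  have "rec_fn n (\<lambda>xs. rec_nat (a xs) (\<lambda>k y. Suc y) (b xs))" by simp
  moreover have "rec_nat u (\<lambda>k y. Suc y) v = u + v" for u v :: nat by (induction v) auto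
  ultimately show ?thesis by simp
qed

lemma rec_fn_drop:
  assumes "rec_fn n h"
  shows "rec_fn (k + n) (\<lambda>xs. h (drop k xs))"
proof -
  have *: "rec_fn (length (map (\<lambda>i xs. xs ! i) [k..<k+n])) h" using assms by simp
  have "rec_fn (k + n) (\<lambda>xs. h (map ((!) xs) [k..<k+n]))"
    using rec_fn_comp[OF *, of "k + n"] by (auto simp: rec_fn_proj comp_def)
  moreover have "map ((!) xs) [k..<k+n] = drop k xs" if "length xs = k + n" for xs :: "nat list"
    by (rule nth_equalityI) (auto simp: that)
  ultimately show ?thesis by (auto intro: rec_fn_cong)
qed

text \<open>The closure property behind all codes below: a product is a sum of equal terms, the
  triangular numbers in \<open>prod_encode\<close> are sums, and set codes are sums of powers of 2.
  The summation index is the additional first argument of \<open>t\<close>.\<close>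

lemma rec_fn_sum:
  assumes t: "rec_fn (Suc n) t" and a: "rec_fn n a"
  shows "rec_fn n (\<lambda>xs. \<Sum>k<a xs. t (k # xs))"
proof -
  have "rec_fn (length ((\<lambda>ys. ys ! 0) # map (\<lambda>i ys. ys ! (Suc (Suc i))) [0..<n])) t"
    using t by simp
  from rec_fn_comp[OF this, of "Suc (Suc n)"]
  have "rec_fn (Suc (Suc n)) (\<lambda>ys. t (ys ! 0 # map (\<lambda>i. ys ! Suc (Suc i)) [0..<n]))"
    by (auto simp: rec_fn_proj comp_def)
  then have "rec_fn (Suc (Suc n)) (\<lambda>ys. ys ! 1 + t (ys ! 0 # map (\<lambda>i. ys ! Suc (Suc i)) [0..<n]))"
    by (intro rec_fn_add rec_fn_proj) auto
  from rec_fn_rec_nat[OF rec_fn_const[of n 0] this a]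
  have "rec_fn n (\<lambda>xs. rec_nat 0 (\<lambda>k y. y + t (k # map ((!) xs) [0..<n])) (a xs))"
    by (simp add: comp_def)
  moreover have "rec_nat 0 (\<lambda>k y. y + t (k # xs)) m = (\<Sum>k<m. t (k # xs))" for m xs
    by (induction m) auto
  ultimately have "rec_fn n (\<lambda>xs. \<Sum>k<a xs. t (k # map ((!) xs) [0..<n]))" by simp
  then show ?thesis
    by (rule rec_fn_cong) (metis map_nth)
qed

lemma rec_fn_mult:
  assumes "rec_fn n a" "rec_fn n b"
  shows "rec_fn n (\<lambda>xs. a xs * b xs)"
  using rec_fn_sum[OF rec_fn_drop[OF assms(2), of 1, simplified] assms(1)] by simp

lemma rec_fn_power2:
  assumes "rec_fn n a"
  shows "rec_fn n (\<lambda>xs. 2 ^ a xs)"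
proof -
  have "rec_fn (Suc (Suc n)) (\<lambda>ys. 2 * (ys ! 1))"
    by (intro rec_fn_mult rec_fn_const rec_fn_proj) simp
  from rec_fn_rec_nat[OF rec_fn_const[of n 1] this assms]
  have "rec_fn n (\<lambda>xs. rec_nat 1 (\<lambda>k y. 2 * y) (a xs))" by simp
  moreover have "rec_nat 1 (\<lambda>k y. 2 * y) m = (2 :: nat) ^ m" for m
    by (induction m) auto
  ultimately show ?thesis by simp
qed

lemma rec_fn_prod_encode:
  assumes "rec_fn n a" "rec_fn n b"
  shows "rec_fn n (\<lambda>xs. prod_encode (a xs, b xs))"
proof -
  have "triangle m = (\<Sum>k<Suc m. k)" for m
    by (induction m) auto
  then have "prod_encode (u, v) = (\<Sum>k<u + v + 1. k) + u" for u v
    by (simp add: prod_encode_def)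
  moreover have "rec_fn n (\<lambda>xs. (\<Sum>k<a xs + b xs + 1. (k # xs) ! 0) + a xs)"
    by (intro rec_fn_add rec_fn_sum assms rec_fn_const rec_fn_proj) simp
  ultimately show ?thesis by simp
qed

lemma set_encode_lessThan: "set_encode {..<n} = (\<Sum>k<n. 2 ^ k)"
  by (simp add: set_encode_def)

section \<open>Counter programs\<close>

type_synonym store = "nat \<Rightarrow> nat"

datatype instr = Inc nat | Dec nat | IsZero nat | Skip

fun exec :: "instr \<Rightarrow> store \<Rightarrow> store \<Rightarrow> bool" where
  "exec (Inc i) s s' \<longleftrightarrow> s' = s(i := Suc (s i))"
| "exec (Dec i) s s' \<longleftrightarrow> 0 < s i \<and> s' = s(i := s i - 1)"
| "exec (IsZero i) s s' \<longleftrightarrow> s i = 0 \<and> s' = s"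
| "exec Skip s s' \<longleftrightarrow> s' = s"

datatype cmd = Atom instr | Seq cmd cmd (infixr ";;" 60) | Loop cmd

primrec sem :: "cmd \<Rightarrow> store \<Rightarrow> store \<Rightarrow> bool" where
  "sem (Atom i) = exec i"
| "sem (c ;; d) = sem c OO sem d"
| "sem (Loop c) = (sem c)\<^sup>*\<^sup>*"

lemma sem_Seq: "sem (c ;; d) s s' \<longleftrightarrow> (\<exists>t. sem c s t \<and> sem d t s')"
  by auto

lemma sem_Loop_Seq:
  "sem (Loop c ;; d) s s' \<longleftrightarrow> sem d s s' \<or> (\<exists>t. sem c s t \<and> sem (Loop c ;; d) t s')"
  by (auto simp: relcompp_apply intro: converse_rtranclp_into_rtranclp elim: converse_rtranclpE)

declare sem.simps(2,3) [simp del]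

primrec incs :: "nat list \<Rightarrow> cmd" where
  "incs [] = Atom Skip"
| "incs (b # bs) = Atom (Inc b) ;; incs bs"

definition drain :: "nat \<Rightarrow> nat list \<Rightarrow> cmd" where
  "drain a bs = Loop (Atom (Dec a) ;; incs bs) ;; Atom (IsZero a)"

text \<open>The semantics of the basic commands are equations of the form \<open>s' = f\<close>;
  comparing two of them is reduced to comparing the stores register by register.\<close>

lemma store_eq_cong: "(\<And>j. f j = g j) \<Longrightarrow> s' = f \<longleftrightarrow> s' = g" for s' :: store
  by (simp add: fun_eq_iff)

lemma sem_incs:
  "distinct bs \<Longrightarrow> sem (incs bs) s s' \<longleftrightarrow> s' = (\<lambda>j. if j \<in> set bs then Suc (s j) else s j)"
proof (induction bs arbitrary: s)
  case (Cons b bs)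
  then show ?case by (simp add: sem_Seq) (rule store_eq_cong, auto)
qed auto

text \<open>The loop may stop after any round, but the final zero test rejects every exit with a
  positive \<open>a\<close>. So exactly \<open>s a\<close> rounds are performed, each adding one to
  all of \<open>bs\<close>.\<close>

lemma sem_drain:
  assumes "distinct (a # bs)"
  shows "sem (drain a bs) s s' \<longleftrightarrow>
    s' = (\<lambda>j. if j = a then 0 else if j \<in> set bs then s j + s a else s j)"
proof (induction "s a" arbitrary: s)
  case 0
  then show ?case
    unfolding drain_def
    by (subst sem_Loop_Seq, simp add: sem_Seq[of "Atom _"]) (rule store_eq_cong, auto)
next
  case (Suc n)
  define t where "t = (\<lambda>j. if j \<in> set bs then Suc (s j) else if j = a then n else s j)"
  have "sem (Atom (Dec a) ;; incs bs) s u \<longleftrightarrow> u = t" for u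
    using Suc(2)[symmetric] assms
    by (simp add: sem_Seq sem_incs t_def) (rule store_eq_cong, auto)
  then have "sem (drain a bs) s s' \<longleftrightarrow> sem (drain a bs) t s'"
    using Suc(2) unfolding drain_def by (subst sem_Loop_Seq) simp
  also have "\<dots> \<longleftrightarrow> s' = (\<lambda>j. if j = a then 0 else if j \<in> set bs then t j + t a else t j)"
    using assms by (intro Suc) (auto simp: t_def)
  also have "\<dots> \<longleftrightarrow> s' = (\<lambda>j. if j = a then 0 else if j \<in> set bs then s j + s a else s j)"
    using assms Suc(2)[symmetric] by (intro store_eq_cong) (auto simp: t_def)
  finally show ?case .
qed

lemma sem_drain_Nil: "sem (drain a []) s s' \<longleftrightarrow> s' = s(a := 0)"
  by (simp add: sem_drain) (rule store_eq_cong, auto)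

lemma sem_drain_single: "a \<noteq> b \<Longrightarrow> sem (drain a [b]) s s' \<longleftrightarrow> s' = s(a := 0, b := s b + s a)"
  by (simp add: sem_drain) (rule store_eq_cong, auto)

text \<open>Reading a counter destroys it. The temporary register \<open>t\<close> receives a second
  copy, from which \<open>a\<close> is restored.\<close>

definition copy :: "nat \<Rightarrow> nat \<Rightarrow> nat \<Rightarrow> cmd" where
  "copy a b t = drain a [b, t] ;; drain t [a]"

lemma sem_copy:
  assumes "distinct [a, b, t]" "s t = 0"
  shows "sem (copy a b t) s s' \<longleftrightarrow> s' = s(b := s b + s a)"
  using assms by (simp add: copy_def sem_Seq sem_drain) (rule store_eq_cong, auto)

primrec clears :: "nat list \<Rightarrow> cmd" where
  "clears [] = Atom Skip"
| "clears (b # bs) = drain b [] ;; clears bs"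

lemma sem_clears: "sem (clears bs) s s' \<longleftrightarrow> s' = (\<lambda>j. if j \<in> set bs then 0 else s j)"
proof (induction bs arbitrary: s)
  case (Cons b bs)
  then show ?case by (simp add: sem_Seq sem_drain_Nil) (rule store_eq_cong, auto)
qed simp

text \<open>
  \<open>compile f as out n\<close> adds the value of \<open>f\<close> on the registers \<open>as\<close> to the register \<open>out\<close>.
  The registers from \<open>n\<close> on are scratch space: they are zero before and after. Hence
  \<open>Atom (Dec n)\<close> blocks, which handles argument tuples outside the domain of \<open>f\<close>.
\<close>
fun compile :: "recf \<Rightarrow> nat list \<Rightarrow> nat \<Rightarrow> nat \<Rightarrow> cmd"
and compiles :: "recf list \<Rightarrow> nat list \<Rightarrow> nat \<Rightarrow> nat \<Rightarrow> cmd" where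
  "compile Zero as out n = Atom Skip"
| "compile Succ as out n =
    (if length as = 1 then copy (hd as) out n ;; Atom (Inc out) else Atom (Dec n))"
| "compile (Proj i) as out n = (if i < length as then copy (as ! i) out n else Atom (Dec n))"
| "compile (Comp f gs) as out n =
    compiles gs as n (n + length gs) ;;
    compile f [n..<n + length gs] out (n + length gs) ;;
    clears [n..<n + length gs]"
| "compile (PrimRec f g) as out n =
    (case as of
      [] \<Rightarrow> Atom (Dec n)
    | a # bs \<Rightarrow>
        copy a n (n + 4) ;;
        compile f bs (n + 2) (n + 4) ;;
        (Loop (Atom (Dec n) ;;
               compile g ((n + 1) # (n + 2) # bs) (n + 3) (n + 4) ;;
               drain (n + 2) [] ;;
               drain (n + 3) [n + 2] ;;
               Atom (Inc (n + 1))) ;;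
         Atom (IsZero n)) ;;
        drain (n + 1) [] ;;
        drain (n + 2) [out])"
| "compile (Mu f) as out n =
    (Loop (compile f (n # as) (n + 1) (n + 2) ;;
           Atom (Dec (n + 1)) ;;
           drain (n + 1) [] ;;
           Atom (Inc n)) ;;
     compile f (n # as) (n + 1) (n + 2) ;;
     Atom (IsZero (n + 1))) ;;
    drain n [out]"
| "compiles [] as k n = Atom Skip"
| "compiles (g # gs) as k n = compile g as k n ;; compiles gs as (Suc k) n"

section \<open>Correctness of the compilation\<close>

lemma computes_PrimRec_SucD:
  "computes (PrimRec f g) (Suc n # xs) z \<Longrightarrow>
    \<exists>y. computes (PrimRec f g) (n # xs) y \<and> computes g (n # y # xs) z"
  by (erule computes.cases) auto

lemma computes_PrimRec_0_iff: "computes (PrimRec f g) (0 # xs) z \<longleftrightarrow> computes f xs z"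
  by (auto intro: computes.PrimRec_0 elim: computes.cases)

text \<open>A value at \<open>m + k\<close> is built from values at all smaller arguments, so
  definedness is inherited downwards. Hence no early round of the compiled recursion blocks if the
  final value exists.\<close>

lemma computes_PrimRec_less:
  "computes (PrimRec f g) ((m + k) # xs) z \<Longrightarrow> \<exists>y. computes (PrimRec f g) (m # xs) y"
  by (induction k arbitrary: z) (auto dest!: computes_PrimRec_SucD)

text \<open>Register \<open>r\<close> counts the remaining rounds down, \<open>i\<close> counts the
  finished ones up, and \<open>y\<close> holds the value of the recursion at \<open>i\<close>. The
  sum \<open>s i + s r\<close> is constant and is the argument at which the recursion is finally
  evaluated; the induction is on \<open>s r\<close>.\<close>

lemma sem_PrimRec_loop:
  assumes body: "\<And>s s'. invar s \<Longrightarrow> sem c s s' \<longleftrightarrow> 0 < s r \<and>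
      (\<exists>z. computes g (s i # s y # xs) z \<and> s' = s(r := s r - 1, y := z, i := Suc (s i)))"
    and invar: "\<And>s u v w. invar s \<Longrightarrow> invar (s(r := u, y := v, i := w))"
    and "distinct [r, y, i]"
    and "invar s" and "computes (PrimRec f g) (s i # xs) (s y)"
  shows "sem (Loop c ;; Atom (IsZero r)) s s' \<longleftrightarrow>
    (\<exists>v. computes (PrimRec f g) ((s i + s r) # xs) v \<and> s' = s(r := 0, y := v, i := s i + s r))"
  using assms(4,5)
proof (induction "s r" arbitrary: s)
  case 0
  have "computes (PrimRec f g) (s i # xs) v \<longleftrightarrow> v = s y" for v
    using 0 computes_deterministic by blast
  moreover have "s(r := 0, y := s y, i := s i + 0) = s"
    using 0 by auto
  ultimately show ?case
    using 0 by (subst sem_Loop_Seq) (auto simp: body)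
next
  case (Suc n)
  let ?t = "\<lambda>z. s(r := n, y := z, i := Suc (s i))"
  have neq: "r \<noteq> y" "r \<noteq> i" "y \<noteq> i" "y \<noteq> r" "i \<noteq> r" "i \<noteq> y" using assms(3) by auto
  have g: "computes (PrimRec f g) (Suc (s i) # xs) z" if "computes g (s i # s y # xs) z" for z
    using that Suc.prems computes.PrimRec_Suc by blast
  have IH: "sem (Loop c ;; Atom (IsZero r)) (?t z) s' \<longleftrightarrow>
      (\<exists>v. computes (PrimRec f g) ((s i + s r) # xs) v \<and> s' = s(r := 0, y := v, i := s i + s r))"
    if "computes g (s i # s y # xs) z" for z
  proof -
    have "(?t z)(r := 0, y := v, i := s i + s r) = s(r := 0, y := v, i := s i + s r)" for v
      by (intro ext) auto
    then show ?thesis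
      using Suc(1)[of "?t z"] g[OF that] invar[OF Suc.prems(1)] neq Suc(2)[symmetric] by simp
  qed
  have "\<exists>z. computes g (s i # s y # xs) z"
    if "computes (PrimRec f g) ((s i + s r) # xs) v" for v
  proof -
    have "computes (PrimRec f g) ((Suc (s i) + n) # xs) v"
      using that Suc(2)[symmetric] by simp
    then obtain z where "computes (PrimRec f g) (Suc (s i) # xs) z"
      using computes_PrimRec_less by blast
    then obtain u where u: "computes (PrimRec f g) (s i # xs) u" "computes g (s i # u # xs) z"
      using computes_PrimRec_SucD by blast
    then have "u = s y" using Suc.prems(2) computes_deterministic by blast
    with u show ?thesis by blast
  qed
  moreover have "sem (Loop c ;; Atom (IsZero r)) s s' \<longleftrightarrow>
      (\<exists>z. computes g (s i # s y # xs) z \<and> sem (Loop c ;; Atom (IsZero r)) (?t z) s')"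
    using Suc(2)[symmetric] Suc.prems(1) by (subst sem_Loop_Seq) (auto simp: body)
  ultimately show ?case using IH by blast
qed

text \<open>Body and exit both evaluate \<open>f\<close> at the current candidate; the body passes
  only for a positive value and the exit only for zero. So the nondeterministic choice of when to
  leave the loop is forced. The iterations passed so far provide the witnesses that all smaller
  candidates fail.\<close>

lemma sem_Mu_loop:
  assumes body: "\<And>s s'. invar s \<Longrightarrow> sem c s s' \<longleftrightarrow>
      (\<exists>v. computes f (s i # xs) v \<and> 0 < v \<and> s' = s(i := Suc (s i)))"
    and exit: "\<And>s s'. invar s \<Longrightarrow> sem d s s' \<longleftrightarrow> computes f (s i # xs) 0 \<and> s' = s"
    and invar: "\<And>s u. invar s \<Longrightarrow> invar (s(i := u))"
    and "invar s" "s i = 0"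
  shows "sem (Loop c ;; d) s s' \<longleftrightarrow> (\<exists>n. computes (Mu f) xs n \<and> s' = s(i := n))"
proof
  assume "sem (Loop c ;; d) s s'"
  then obtain t where t: "(sem c)\<^sup>*\<^sup>* s t" "sem d t s'"
    by (auto simp: sem.simps)
  from t(1) have *: "t = s(i := t i) \<and> (\<forall>k<t i. \<exists>y. y \<noteq> 0 \<and> computes f (k # xs) y)"
  proof (induction rule: rtranclp_induct)
    case base
    then show ?case using assms(5) by auto
  next
    case (step t u)
    then have "invar t" using invar[OF assms(4)] by metis
    then obtain v where v: "computes f (t i # xs) v" "0 < v" and u: "u = t(i := Suc (t i))"
      using step(2) body by blast
    have "\<exists>y. y \<noteq> 0 \<and> computes f (k # xs) y" if "k < u i" for k
      using that conjunct2[OF step(3)] v by (auto simp: u less_Suc_eq)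
    moreover have "u = s(i := u i)"
      using conjunct1[OF step(3)] by (metis u fun_upd_same fun_upd_upd)
    ultimately show ?case by blast
  qed
  then have "invar t" using invar[OF assms(4)] by metis
  then have "computes f (t i # xs) 0" "s' = t"
    using t(2) exit by auto
  then have "computes (Mu f) xs (t i)"
    using conjunct2[OF *] by (intro computes.Mu) auto
  with * \<open>s' = t\<close> show "\<exists>n. computes (Mu f) xs n \<and> s' = s(i := n)" by metis
next
  assume "\<exists>n. computes (Mu f) xs n \<and> s' = s(i := n)"
  then obtain n where n: "computes (Mu f) xs n" and s': "s' = s(i := n)" by blast
  from n have zero: "computes f (n # xs) 0"
    and pos: "\<And>k. k < n \<Longrightarrow> \<exists>y. y \<noteq> 0 \<and> computes f (k # xs) y"
    by (cases, blast)+
  have "(sem c)\<^sup>*\<^sup>* s (s(i := k))" if "k \<le> n" for k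
    using that
  proof (induction k)
    case 0
    show ?case using assms(5) by (metis fun_upd_triv rtranclp.rtrancl_refl)
  next
    case (Suc k)
    then have "sem c (s(i := k)) (s(i := Suc k))"
      using pos[of k] invar[OF assms(4)] by (auto simp: body)
    with Suc show ?case by (metis Suc_leD rtranclp.rtrancl_into_rtrancl)
  qed
  from this[of n] zero show "sem (Loop c ;; d) s s'"
    using exit[OF invar[OF assms(4)]] by (auto simp: sem.simps s')
qed

lemma computes_Comp_iff:
  "computes (Comp f gs) xs z \<longleftrightarrow>
    (\<exists>ys. list_all2 (\<lambda>g y. computes g xs y) gs ys \<and> computes f ys z)"
  by (auto intro: computes.Comp elim: computes.cases)

definition adds :: "(nat \<Rightarrow> bool) \<Rightarrow> nat \<Rightarrow> store \<Rightarrow> store \<Rightarrow> bool" where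
  [simp]: "adds P out s s' \<longleftrightarrow> (\<exists>y. P y \<and> s' = s(out := s out + y))"

text \<open>The equivalence is essential: where \<open>f\<close> is undefined there must be no
  terminating run at all, whether by blocking or by divergence. In the part for
  \<open>compiles\<close> the target registers start at zero and therefore end up holding the values
  themselves.\<close>

lemma sem_compile:
  "set as \<subseteq> {..<n} \<Longrightarrow> out < n \<Longrightarrow> out \<notin> set as \<Longrightarrow> \<forall>j\<ge>n. s j = 0 \<Longrightarrow>
    sem (compile f as out n) s s' \<longleftrightarrow>
      adds (computes f (map s as)) out s s'"
  "set as \<subseteq> {..<k} \<Longrightarrow> n = k + length gs \<Longrightarrow> \<forall>j\<ge>k. s j = 0 \<Longrightarrow>
    sem (compiles gs as k n) s s' \<longleftrightarrow>
      (\<exists>ys. list_all2 (\<lambda>g y. computes g (map s as) y) gs ys \<and>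
        s' = (\<lambda>j. if k \<le> j \<and> j < n then ys ! (j - k) else s j))"
proof (induction f as out n and gs as k n arbitrary: s s' and s s' rule: compile_compiles.induct)
  case (1 as out n)
  have "computes Zero xs y \<longleftrightarrow> y = 0" for xs y
    by (auto intro: computes.Zero elim: computes.cases)
  then show ?case by simp
next
  case (2 as out n)
  have "computes Succ xs y \<longleftrightarrow> length xs = 1 \<and> y = Suc (hd xs)" for xs y
    by (auto intro: computes.Succ elim: computes.cases simp: length_Suc_conv)
  note Succ = this
  show ?case
  proof (cases "length as = 1")
    case True
    then obtain a where "as = [a]" by (auto simp: length_Suc_conv)
    then show ?thesis using 2 by (auto simp: Succ sem_Seq sem_copy)
  qed (use 2 Succ in auto)
next
  case (3 i as out n)
  have "computes (Proj i) xs y \<longleftrightarrow> i < length xs \<and> y = xs ! i" for xs y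
    by (auto intro: computes.Proj elim: computes.cases)
  note Proj = this
  show ?case
  proof (cases "i < length as")
    case True
    then have "as ! i \<in> set as" by simp
    then have "distinct [as ! i, out, n]" using 3 by auto
    with True show ?thesis using 3 by (simp add: Proj sem_copy)
  qed (use 3 Proj in auto)
next
  case (4 f gs as out n)
  let ?n = "n + length gs"
  define t where "t = (\<lambda>ys j. if n \<le> j \<and> j < ?n then ys ! (j - n) else s j)"
  have gs: "sem (compiles gs as n ?n) s u \<longleftrightarrow>
      (\<exists>ys. list_all2 (\<lambda>g y. computes g (map s as) y) gs ys \<and> u = t ys)" for u
    unfolding t_def using 4 by (intro 4(1)) auto
  have f: "sem (compile f [n..<?n] out ?n) (t ys) u \<longleftrightarrow>
      (\<exists>y. computes f ys y \<and> u = (t ys)(out := s out + y))" if "length ys = length gs" for ys u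
  proof -
    have "map (t ys) [n..<?n] = ys"
      by (rule nth_equalityI) (auto simp: t_def that)
    moreover have "t ys out = s out" using 4 by (auto simp: t_def)
    moreover have "sem (compile f [n..<?n] out ?n) (t ys) u \<longleftrightarrow>
        adds (computes f (map (t ys) [n..<?n])) out (t ys) u"
      using 4(3-) by (intro 4(2)) (auto simp: t_def)
    ultimately show ?thesis by simp
  qed
  have cl: "sem (clears [n..<?n]) ((t ys)(out := s out + y)) u \<longleftrightarrow> u = s(out := s out + y)" for ys y u
    using 4(3-) by (simp add: sem_clears) (rule store_eq_cong, auto simp: t_def)
  have "sem (compile (Comp f gs) as out n) s s' \<longleftrightarrow>
     (\<exists>ys. list_all2 (\<lambda>g y. computes g (map s as) y) gs ys \<and>
       (\<exists>y. computes f ys y \<and> s' = s(out := s out + y)))"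
    by (auto simp: sem_Seq gs f cl dest: list_all2_lengthD; metis f cl list_all2_lengthD)
  then show ?case by (auto simp: computes_Comp_iff)
next
  case (5 f g as out n)
  show ?case
  proof (cases as)
    case Nil
    have "\<not> computes (PrimRec f g) [] y" for y by (auto elim: computes.cases)
    with Nil 5 show ?thesis by simp
  next
    case (Cons a bs)
    let ?c = "Atom (Dec n) ;; compile g ((n + 1) # (n + 2) # bs) (n + 3) (n + 4) ;;
      drain (n + 2) [] ;; drain (n + 3) [n + 2] ;; Atom (Inc (n + 1))"
    \<comment> \<open>Only the round counter, the index and the accumulator at \<open>n\<close>,
      \<open>n + 1\<close>, \<open>n + 2\<close> survive a round with changed values; the result
      register \<open>n + 3\<close> is zero again.\<close>
    define invar where "invar t \<longleftrightarrow> (\<forall>j. j < n \<or> n + 3 \<le> j \<longrightarrow> t j = s j)" for t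
    note prems = 5(3-)[unfolded Cons, simplified]
    have bs: "map t bs = map s bs" if "invar t" for t
      using prems that by (auto simp: invar_def)
    have body: "sem ?c t t' \<longleftrightarrow> 0 < t n \<and>
        (\<exists>z. computes g (t (n + 1) # t (n + 2) # map s bs) z \<and>
          t' = t(n := t n - 1, n + 2 := z, n + 1 := Suc (t (n + 1))))" if "invar t" for t t'
    proof -
      have "sem (compile g ((n + 1) # (n + 2) # bs) (n + 3) (n + 4)) (t(n := x)) u \<longleftrightarrow>
        (\<exists>z. computes g (t (n + 1) # t (n + 2) # map s bs) z \<and> u = t(n := x, n + 3 := z))" for u x
      proof -
        have "map (t(n := x)) ((n + 1) # (n + 2) # bs) = t (n + 1) # t (n + 2) # map s bs"
          using prems bs[OF that] by auto
        moreover have "(t(n := x)) (n + 3) = 0" using that prems by (auto simp: invar_def)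
        moreover have "sem (compile g ((n + 1) # (n + 2) # bs) (n + 3) (n + 4)) (t(n := x)) u \<longleftrightarrow>
            adds (computes g (map (t(n := x)) ((n + 1) # (n + 2) # bs))) (n + 3) (t(n := x)) u"
          using prems that by (intro 5(2)[OF Cons]) (auto simp: invar_def)
        ultimately show ?thesis unfolding adds_def by (simp only: add_0)
      qed
      moreover have "sem (drain (n + 2) [] ;; drain (n + 3) [n + 2] ;; Atom (Inc (n + 1)))
          (t(n := x, n + 3 := z)) t' \<longleftrightarrow> t' = t(n := x, n + 2 := z, n + 1 := Suc (t (n + 1)))" for x z
      proof -
        have "t (n + 3) = 0" using that prems by (auto simp: invar_def)
        then show ?thesis
          by (simp add: sem_Seq sem_drain_Nil sem_drain_single) (rule store_eq_cong, auto)
      qed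
      ultimately show ?thesis
        unfolding sem_Seq[of "Atom _"] sem_Seq[of "compile _ _ _ _"] by auto
    qed
    have inv_upd: "invar (t(n := u, n + 2 := v, n + 1 := w))" if "invar t" for t u v w
      using that by (auto simp: invar_def)
    have loop: "sem (Loop ?c ;; Atom (IsZero n)) (s(n := s a, n + 2 := y)) t \<longleftrightarrow>
        (\<exists>v. computes (PrimRec f g) (s a # map s bs) v \<and> t = s(n := 0, n + 2 := v, n + 1 := s a))"
      if "computes f (map s bs) y" for y t
    proof -
      let ?s = "s(n := s a, n + 2 := y)"
      have "sem (Loop ?c ;; Atom (IsZero n)) ?s t \<longleftrightarrow>
        (\<exists>v. computes (PrimRec f g) ((?s (n + 1) + ?s n) # map s bs) v \<and>
          t = ?s(n := 0, n + 2 := v, n + 1 := ?s (n + 1) + ?s n))"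
      proof (rule sem_PrimRec_loop[where invar = invar, OF body inv_upd])
        show "computes (PrimRec f g) (?s (n + 1) # map s bs) (?s (n + 2))"
          using prems that by (simp add: computes_PrimRec_0_iff)
      qed (auto simp: invar_def)
      moreover have "?s(n := 0, n + 2 := v, n + 1 := s a) = s(n := 0, n + 2 := v, n + 1 := s a)" for v
        by auto
      ultimately show ?thesis using prems by simp
    qed
    have f: "sem (compile f bs (n + 2) (n + 4)) (s(n := s a)) t \<longleftrightarrow>
        (\<exists>y. computes f (map s bs) y \<and> t = s(n := s a, n + 2 := y))" for t
    proof -
      have "map (s(n := s a)) bs = map s bs" using prems by auto
      moreover have "sem (compile f bs (n + 2) (n + 4)) (s(n := s a)) t \<longleftrightarrow>
          adds (computes f (map (s(n := s a)) bs)) (n + 2) (s(n := s a)) t"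
        using prems by (intro 5(1)[OF Cons]) auto
      moreover have "(s(n := s a)) (n + 2) = 0" using prems by simp
      ultimately show ?thesis unfolding adds_def by (simp only: add_0)
    qed
    have drains: "(\<exists>x. sem (drain (n + 1) []) (s(n := 0, n + 2 := v, n + 1 := s a)) x \<and>
        sem (drain (n + 2) [out]) x s') \<longleftrightarrow> s' = s(out := s out + v)" for v
      using prems by (simp add: sem_drain_Nil sem_drain_single) (rule store_eq_cong, auto)
    have tail: "(\<exists>t. sem (Loop ?c ;; Atom (IsZero n)) (s(n := s a, n + 2 := y)) t \<and>
          (\<exists>x. sem (drain (n + 1) []) t x \<and> sem (drain (n + 2) [out]) x s')) \<longleftrightarrow>
        (\<exists>v. computes (PrimRec f g) (s a # map s bs) v \<and> s' = s(out := s out + v))"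
      if "computes f (map s bs) y" for y
      unfolding loop[OF that] drains[symmetric] by blast
    have copy: "sem (copy a n (n + 4)) s t \<longleftrightarrow> t = s(n := s a)" for t
      using prems by (auto simp: sem_copy)
    have "sem (compile (PrimRec f g) (a # bs) out n) s s' \<longleftrightarrow>
        (\<exists>y. computes f (map s bs) y \<and>
          (\<exists>v. computes (PrimRec f g) (s a # map s bs) v \<and> s' = s(out := s out + v)))"
      unfolding compile.simps list.case sem_Seq[of "copy _ _ _"] sem_Seq[of "compile _ _ _ _"]
        sem_Seq[of "Loop _ ;; _"] sem_Seq[of "drain _ _"] copy simp_thms f
      using tail by blast
    \<comment> \<open>The program evaluates \<open>f\<close> before the loop. This costs no
      definedness, because a value of the recursion at \<open>s a\<close> presupposes one at
      0.\<close>
    moreover have "\<exists>y. computes f (map s bs) y" if "computes (PrimRec f g) (s a # map s bs) v" for v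
      using computes_PrimRec_less[of f g 0] that by (auto simp: computes_PrimRec_0_iff)
    ultimately show ?thesis
      unfolding Cons list.map adds_def by blast
  qed
next
  case (6 f as out n)
  define invar where "invar t \<longleftrightarrow> (\<forall>j. j \<noteq> n \<longrightarrow> t j = s j)" for t
  note prems = 6(2-)
  have f: "sem (compile f (n # as) (n + 1) (n + 2)) t u \<longleftrightarrow>
      (\<exists>y. computes f (t n # map s as) y \<and> u = t(n + 1 := y))" if "invar t" for t u
  proof -
    have "map t (n # as) = t n # map s as" "t (n + 1) = 0"
      using prems that by (auto simp: invar_def)
    moreover have "sem (compile f (n # as) (n + 1) (n + 2)) t u \<longleftrightarrow>
        adds (computes f (map t (n # as))) (n + 1) t u"
      using prems that by (intro 6(1)) (auto simp: invar_def)
    ultimately show ?thesis unfolding adds_def by (simp only: add_0)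
  qed
  have t1: "t (n + 1) = 0" if "invar t" for t using prems that by (auto simp: invar_def)
  have body: "sem (compile f (n # as) (n + 1) (n + 2) ;; Atom (Dec (n + 1)) ;;
      drain (n + 1) [] ;; Atom (Inc n)) t u \<longleftrightarrow>
      (\<exists>v. computes f (t n # map s as) v \<and> 0 < v \<and> u = t(n := Suc (t n)))" if "invar t" for t u
  proof -
    have "sem (Atom (Dec (n + 1)) ;; drain (n + 1) [] ;; Atom (Inc n)) (t(n + 1 := y)) u \<longleftrightarrow>
        0 < y \<and> u = t(n := Suc (t n))" for y
      using t1[OF that]
      by (simp add: sem_Seq sem_drain_Nil) (intro conj_cong refl store_eq_cong, auto)
    then show ?thesis
      unfolding sem_Seq[of "compile _ _ _ _"] f[OF that] by auto
  qed
  have exit: "sem (compile f (n # as) (n + 1) (n + 2) ;; Atom (IsZero (n + 1))) t u \<longleftrightarrow>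
      computes f (t n # map s as) 0 \<and> u = t" if "invar t" for t u
  proof -
    have "t(n + 1 := 0) = t" using t1[OF that] by auto
    then show ?thesis
      unfolding sem_Seq[of "compile _ _ _ _"] f[OF that] using t1[OF that] by auto
  qed
  have "sem (compile (Mu f) as out n) s s' \<longleftrightarrow>
    (\<exists>t. (\<exists>m. computes (Mu f) (map s as) m \<and> t = s(n := m)) \<and> sem (drain n [out]) t s')"
    unfolding compile.simps sem_Seq[of "Loop _ ;; _"]
    by (subst sem_Mu_loop[where invar = invar and i = n, OF body exit])
      (use prems in \<open>auto simp: invar_def\<close>)
  moreover have "sem (drain n [out]) (s(n := m)) s' \<longleftrightarrow> s' = s(out := s out + m)" for m
    using prems by (simp add: sem_drain_single) (rule store_eq_cong, auto)
  ultimately show ?case by auto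
next
  case (7 as k n)
  then show ?case by simp (rule store_eq_cong, auto)
next
  case (8 g gs as k n)
  note prems = 8(3-)
  have "sem (compile g as k n) s t \<longleftrightarrow> adds (computes g (map s as)) k s t" for t
    using prems by (intro 8(1)) auto
  with prems have g: "sem (compile g as k n) s t \<longleftrightarrow> (\<exists>y. computes g (map s as) y \<and> t = s(k := y))" for t
    by simp
  have gs: "sem (compiles gs as (Suc k) n) (s(k := y)) t \<longleftrightarrow>
      (\<exists>ys. list_all2 (\<lambda>g y. computes g (map s as) y) gs ys \<and>
        t = (\<lambda>j. if k \<le> j \<and> j < n then (y # ys) ! (j - k) else s j))" for y t
  proof -
    have "map (s(k := y)) as = map s as" using prems by auto
    moreover have "(\<lambda>j. if Suc k \<le> j \<and> j < n then ys ! (j - Suc k) else (s(k := y)) j) =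
      (\<lambda>j. if k \<le> j \<and> j < n then (y # ys) ! (j - k) else s j)" for ys
      using prems by (intro ext) (auto simp: nth_Cons' Suc_le_eq)
    moreover have "sem (compiles gs as (Suc k) n) (s(k := y)) t \<longleftrightarrow>
      (\<exists>ys. list_all2 (\<lambda>g y'. computes g (map (s(k := y)) as) y') gs ys \<and>
        t = (\<lambda>j. if Suc k \<le> j \<and> j < n then ys ! (j - Suc k) else (s(k := y)) j))"
      using prems by (intro 8(2)) auto
    ultimately show ?thesis by (simp only:)
  qed
  define t where "t ys = (\<lambda>j. if k \<le> j \<and> j < n then ys ! (j - k) else s j)" for ys
  have "sem (compiles (g # gs) as k n) s s' \<longleftrightarrow> (\<exists>y ys. computes g (map s as) y \<and>
      list_all2 (\<lambda>g y. computes g (map s as) y) gs ys \<and> s' = t (y # ys))"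
    unfolding compiles.simps sem_Seq g t_def using gs by blast
  also have "\<dots> \<longleftrightarrow> (\<exists>ys. list_all2 (\<lambda>g y. computes g (map s as) y) (g # gs) ys \<and> s' = t ys)"
    unfolding list_all2_Cons1 by blast
  finally show ?case unfolding t_def .
qed

section \<open>A program accepting the zeros of a function\<close>

definition acceptor :: "recf \<Rightarrow> cmd" where
  "acceptor f = compile f [0] 1 2 ;; Atom (IsZero 1) ;; drain 0 []"

lemma sem_acceptor:
  "sem (acceptor f) ((\<lambda>_. 0)(0 := n)) s \<longleftrightarrow> computes f [n] 0 \<and> s = (\<lambda>_. 0)"
proof -
  define u :: "nat \<Rightarrow> store" where "u y = (\<lambda>_. 0)(0 := n, 1 := y)" for y
  have u0: "u 0 = (\<lambda>_. 0)(0 := n)" unfolding u_def by (rule fun_upd_idem) simp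
  have "sem (compile f [0] 1 2) (u 0) t \<longleftrightarrow> adds (computes f (map (u 0) [0])) 1 (u 0) t" for t
    by (rule sem_compile(1)) (auto simp: u_def)
  moreover have "map (u 0) [0] = [n]" "(u 0)(1 := u 0 1 + y) = u y" for y
    by (auto simp: u_def)
  ultimately have f: "sem (compile f [0] 1 2) (u 0) t \<longleftrightarrow> (\<exists>y. computes f [n] y \<and> t = u y)" for t
    by (simp only: adds_def)
  have "(u 0)(0 := 0) = (\<lambda>_. 0)" by (rule ext) (simp add: u_def)
  moreover have "sem (Atom (IsZero 1) ;; drain 0 []) t s \<longleftrightarrow> t 1 = 0 \<and> s = t(0 := 0)" for t
    by (auto simp: sem_Seq sem_drain_Nil)
  moreover have "u y 1 = y" for y by (simp add: u_def)
  ultimately have "sem (Atom (IsZero 1) ;; drain 0 []) (u y) s \<longleftrightarrow> y = 0 \<and> s = (\<lambda>_. 0)" for y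
    by metis
  then have "(\<exists>t. (\<exists>y. computes f [n] y \<and> t = u y) \<and> sem (Atom (IsZero 1) ;; drain 0 []) t s) \<longleftrightarrow>
      computes f [n] 0 \<and> s = (\<lambda>_. 0)"
    by metis
  then show ?thesis
    by (simp only: acceptor_def sem_Seq[of "compile _ _ _ _"] u0[symmetric] f)
qed

section \<open>Counter machines\<close>

type_synonym edge = "nat \<times> instr \<times> nat"

inductive mstep :: "edge set \<Rightarrow> nat \<times> store \<Rightarrow> nat \<times> store \<Rightarrow> bool" for E where
  "(l, i, l') \<in> E \<Longrightarrow> exec i s s' \<Longrightarrow> mstep E (l, s) (l', s')"

lemma mstep_mono: "mstep E x y \<Longrightarrow> E \<subseteq> E' \<Longrightarrow> mstep E' x y"
  by (auto elim!: mstep.cases intro: mstep.intros)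

lemma msteps_mono: "(mstep E)\<^sup>*\<^sup>* x y \<Longrightarrow> E \<subseteq> E' \<Longrightarrow> (mstep E')\<^sup>*\<^sup>* x y"
  by (metis mstep_mono mono_rtranclp)

definition inductive_annotation :: "edge set \<Rightarrow> (nat \<Rightarrow> store \<Rightarrow> bool) \<Rightarrow> bool" where
  "inductive_annotation E A \<longleftrightarrow>
    (\<forall>(l, i, l')\<in>E. \<forall>s s'. A l s \<longrightarrow> exec i s s' \<longrightarrow> A l' s')"

lemma inductive_annotation_msteps:
  assumes "inductive_annotation E A" "(mstep E)\<^sup>*\<^sup>* (l, s) (l', s')" "A l s"
  shows "A l' s'"
  using assms(2,3)
  by (induction rule: rtranclp_induct2) (use assms(1) in \<open>auto simp: inductive_annotation_def elim!: mstep.cases\<close>)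

lemma inductive_annotation_cong:
  assumes "inductive_annotation E A" "\<And>l i l'. (l, i, l') \<in> E \<Longrightarrow> A' l = A l \<and> A' l' = A l'"
  shows "inductive_annotation E A'"
  using assms unfolding inductive_annotation_def by fastforce

text \<open>
  Soundness is stated in Floyd style: an annotation that is correct for \<open>c\<close> at its entry and
  exit extends to an inductive one on the labels \<open>{n..<n'}\<close> that are used internally.
\<close>
definition implements :: "edge set \<Rightarrow> cmd \<Rightarrow> nat \<Rightarrow> nat \<Rightarrow> nat \<Rightarrow> nat \<Rightarrow> bool" where
  "implements E c l l' n n' \<longleftrightarrow>
    finite E \<and> n \<le> n' \<and>
    (\<forall>(p, i, q)\<in>E. p \<in> {l, l'} \<union> {n..<n'} \<and> q \<in> {l, l'} \<union> {n..<n'}) \<and>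
    (\<forall>s s'. sem c s s' \<longrightarrow> (mstep E)\<^sup>*\<^sup>* (l, s) (l', s')) \<and>
    (\<forall>A. (\<forall>s s'. A l s \<longrightarrow> sem c s s' \<longrightarrow> A l' s') \<longrightarrow>
      (\<exists>A'. (\<forall>j. j \<notin> {n..<n'} \<longrightarrow> A' j = A j) \<and> inductive_annotation E A'))"

lemma implements_labels:
  "implements E c l l' n n' \<Longrightarrow> (p, i, q) \<in> E \<Longrightarrow>
    p \<in> {l, l'} \<union> {n..<n'} \<and> q \<in> {l, l'} \<union> {n..<n'}"
  unfolding implements_def by (elim conjE) fast

lemma implements_complete:
  "implements E c l l' n n' \<Longrightarrow> sem c s s' \<Longrightarrow> (mstep E)\<^sup>*\<^sup>* (l, s) (l', s')"
  unfolding implements_def by (elim conjE) simp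

lemma implements_sound:
  assumes "implements E c l l' n n'" "\<forall>s s'. A l s \<longrightarrow> sem c s s' \<longrightarrow> A l' s'"
  obtains A' where "\<forall>j. j \<notin> {n..<n'} \<longrightarrow> A' j = A j" "inductive_annotation E A'"
proof -
  from assms(1) have "\<forall>A. (\<forall>s s'. A l s \<longrightarrow> sem c s s' \<longrightarrow> A l' s') \<longrightarrow>
      (\<exists>A'. (\<forall>j. j \<notin> {n..<n'} \<longrightarrow> A' j = A j) \<and> inductive_annotation E A')"
    unfolding implements_def by (elim conjE)
  from mp[OF spec[OF this] assms(2)] that show ?thesis by (elim exE conjE)
qed

lemma implements_Atom: "implements {(l, i, l')} (Atom i) l l' n n"
  unfolding implements_def
  by (auto intro: mstep.intros simp: inductive_annotation_def)

text \<open>The label \<open>n\<close> between the two parts is annotated with the strongest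
  postcondition of \<open>c\<close>. The annotation obtained for \<open>c\<close> is then extended
  over \<open>d\<close>; this changes only labels from \<open>n1\<close> on, which no edge of
  \<open>E\<close> touches, so \<open>E\<close> stays inductive.\<close>

lemma implements_Seq:
  assumes "implements E c l n (Suc n) n1" "implements F d n l' n1 n2" "l < n" "l' < n"
  shows "implements (E \<union> F) (c ;; d) l l' n n2"
proof -
  note c = assms(1)[unfolded implements_def] and d = assms(2)[unfolded implements_def]
  have n: "Suc n \<le> n1" "n1 \<le> n2" using c d by auto
  have "(mstep (E \<union> F))\<^sup>*\<^sup>* (l, s) (l', s')" if run: "sem (c ;; d) s s'" for s s'
  proof -
    from run obtain t where "sem c s t" "sem d t s'" by (auto simp: sem_Seq)
    then have "(mstep E)\<^sup>*\<^sup>* (l, s) (n, t)" "(mstep F)\<^sup>*\<^sup>* (n, t) (l', s')"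
      using implements_complete assms(1,2) by blast+
    then have "(mstep (E \<union> F))\<^sup>*\<^sup>* (l, s) (n, t)" "(mstep (E \<union> F))\<^sup>*\<^sup>* (n, t) (l', s')"
      by (auto intro: msteps_mono)
    then show ?thesis by simp
  qed
  moreover have "\<exists>A'. (\<forall>j. j \<notin> {n..<n2} \<longrightarrow> A' j = A j) \<and> inductive_annotation (E \<union> F) A'"
    if A: "\<forall>s s'. A l s \<longrightarrow> sem (c ;; d) s s' \<longrightarrow> A l' s'" for A
  proof -
    define B where "B = A(n := \<lambda>t. \<exists>s. A l s \<and> sem c s t)"
    have "\<forall>s s'. B l s \<longrightarrow> sem c s s' \<longrightarrow> B n s'"
      using assms(3) by (auto simp: B_def)
    from implements_sound[OF assms(1), of B, OF this]
    obtain B' where B': "\<forall>j. j \<notin> {Suc n..<n1} \<longrightarrow> B' j = B j" "inductive_annotation E B'" .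
    have "B' n = B n" "B' l' = A l'"
      using B'(1) assms(4) by (auto simp: B_def)
    then have "\<forall>s s'. B' n s \<longrightarrow> sem d s s' \<longrightarrow> B' l' s'"
      using A by (auto simp: B_def sem_Seq)
    from implements_sound[OF assms(2), of B', OF this]
    obtain C where C: "\<forall>j. j \<notin> {n1..<n2} \<longrightarrow> C j = B' j" "inductive_annotation F C" .
    have "C p = B' p \<and> C q = B' q" if "(p, i, q) \<in> E" for p i q
    proof -
      have "p \<in> {l, n} \<union> {Suc n..<n1} \<and> q \<in> {l, n} \<union> {Suc n..<n1}"
        using implements_labels[OF assms(1) that] .
      then have "p \<notin> {n1..<n2} \<and> q \<notin> {n1..<n2}" using n assms(3) by auto
      with C(1) show ?thesis by blast
    qed
    with B'(2) have "inductive_annotation E C" by (rule inductive_annotation_cong)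
    with C(2) have "inductive_annotation (E \<union> F) C"
      by (auto simp: inductive_annotation_def)
    moreover have "C j = A j" if "j \<notin> {n..<n2}" for j
    proof -
      have "j \<notin> {n1..<n2}" "j \<notin> {Suc n..<n1}" "j \<noteq> n" using that n by auto
      with B'(1) C(1) show ?thesis by (simp add: B_def)
    qed
    ultimately show ?thesis by blast
  qed
  moreover have "p \<in> {l, l'} \<union> {n..<n2} \<and> q \<in> {l, l'} \<union> {n..<n2}" if "(p, i, q) \<in> E \<union> F" for p i q
  proof -
    have "p \<in> {l, n} \<union> {Suc n..<n1} \<union> ({n, l'} \<union> {n1..<n2}) \<and>
        q \<in> {l, n} \<union> {Suc n..<n1} \<union> ({n, l'} \<union> {n1..<n2})"
      using that implements_labels[OF assms(1), of p i q] implements_labels[OF assms(2), of p i q]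
      by auto
    then show ?thesis using n by auto
  qed
  moreover have "finite (E \<union> F)" "n \<le> n2" using c d n by auto
  ultimately show ?thesis unfolding implements_def by blast
qed

text \<open>The head \<open>n\<close> is both entry and exit of the body and is annotated with all
  stores reachable by iterating \<open>c\<close>. The \<open>Skip\<close> edges keep it apart from
  \<open>l\<close> and \<open>l'\<close>, whose annotations are prescribed.\<close>

lemma implements_Loop:
  assumes "implements E c n n (Suc n) n'" "l < n" "l' < n"
  shows "implements (insert (l, Skip, n) (insert (n, Skip, l') E)) (Loop c) l l' n n'"
    (is "implements ?E _ _ _ _ _")
proof -
  note c = assms(1)[unfolded implements_def]
  have n: "Suc n \<le> n'" using c by auto
  have "(mstep ?E)\<^sup>*\<^sup>* (l, s) (l', s')" if "sem (Loop c) s s'" for s s'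
  proof -
    from that have "(sem c)\<^sup>*\<^sup>* s s'" by (simp add: sem.simps)
    then have "(mstep ?E)\<^sup>*\<^sup>* (n, s) (n, s')"
    proof (induction rule: rtranclp_induct)
      case (step t u)
      then have "(mstep E)\<^sup>*\<^sup>* (n, t) (n, u)"
        using implements_complete[OF assms(1)] by blast
      then have "(mstep ?E)\<^sup>*\<^sup>* (n, t) (n, u)" by (rule msteps_mono) auto
      with step show ?case by simp
    qed simp
    moreover have "mstep ?E (l, s) (n, s)" "mstep ?E (n, s') (l', s')"
      by (auto intro: mstep.intros)
    ultimately show ?thesis
      by (meson converse_rtranclp_into_rtranclp rtranclp.rtrancl_into_rtrancl)
  qed
  moreover have "\<exists>A'. (\<forall>j. j \<notin> {n..<n'} \<longrightarrow> A' j = A j) \<and> inductive_annotation ?E A'"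
    if A: "\<forall>s s'. A l s \<longrightarrow> sem (Loop c) s s' \<longrightarrow> A l' s'" for A
  proof -
    define B where "B = A(n := \<lambda>t. \<exists>s. A l s \<and> sem (Loop c) s t)"
    have "\<forall>s s'. B n s \<longrightarrow> sem c s s' \<longrightarrow> B n s'"
      by (auto simp: B_def sem.simps intro: rtranclp.rtrancl_into_rtrancl)
    from implements_sound[OF assms(1), of B, OF this]
    obtain C where C: "\<forall>j. j \<notin> {Suc n..<n'} \<longrightarrow> C j = B j" "inductive_annotation E C" .
    have "C n = B n" "C l = A l" "C l' = A l'"
      using C(1) assms(2,3) by (auto simp: B_def)
    then have "inductive_annotation ?E C"
      using C(2) A by (auto simp: inductive_annotation_def B_def sem.simps)
    moreover have "C j = A j" if "j \<notin> {n..<n'}" for j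
    proof -
      have "j \<notin> {Suc n..<n'}" "j \<noteq> n" using that n by auto
      with C(1) show ?thesis by (simp add: B_def)
    qed
    ultimately show ?thesis by blast
  qed
  moreover have "p \<in> {l, l'} \<union> {n..<n'} \<and> q \<in> {l, l'} \<union> {n..<n'}" if "(p, i, q) \<in> ?E" for p i q
  proof -
    have "p \<in> {l, l', n} \<union> {Suc n..<n'} \<and> q \<in> {l, l', n} \<union> {Suc n..<n'}"
      using that implements_labels[OF assms(1), of p i q] by auto
    then show ?thesis using n by auto
  qed
  moreover have "finite ?E" "n \<le> n'" using c n by auto
  ultimately show ?thesis unfolding implements_def by blast
qed

lemma ex_implements: "l < n \<Longrightarrow> l' < n \<Longrightarrow> \<exists>E n'. implements E c l l' n n'"
proof (induction c arbitrary: l l' n)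
  case (Atom i)
  show ?case using implements_Atom by blast
next
  case (Seq c d)
  from Seq.IH(1)[of l "Suc n" n] Seq.prems obtain E n1 where E: "implements E c l n (Suc n) n1"
    by auto
  then have "Suc n \<le> n1" by (auto simp: implements_def)
  with Seq.IH(2)[of n n1 l'] Seq.prems obtain F n2 where "implements F d n l' n1 n2"
    by auto
  with E Seq.prems show ?case using implements_Seq by blast
next
  case (Loop c)
  from Loop.IH[of n "Suc n" n] obtain E n' where "implements E c n n (Suc n) n'"
    by auto
  with Loop.prems show ?case using implements_Loop by blast
qed

text \<open>The edges \<open>loader n\<close> count the number \<open>n\<close> into register 0 before the label 0 is entered.\<close>
definition loader :: "nat \<Rightarrow> edge set" where
  "loader n = insert (n, Skip, 0) ((\<lambda>k. (Suc (n + k), Inc 0, n + k)) ` {..<n})"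

lemma msteps_loader: "(mstep (loader n))\<^sup>*\<^sup>* (2 * n, \<lambda>_. 0) (0, (\<lambda>_. 0)(0 := n))"
proof -
  have "(mstep (loader n))\<^sup>*\<^sup>* (2 * n, \<lambda>_. 0) (n + k, (\<lambda>_. 0)(0 := n - k))" if "k \<le> n" for k
    using that
  proof (induction rule: inc_induct)
    case base
    show ?case by (simp add: mult_2)
  next
    case (step k)
    have "mstep (loader n) (n + Suc k, (\<lambda>_. 0)(0 := n - Suc k)) (n + k, (\<lambda>_. 0)(0 := n - k))"
      by (rule mstep.intros[of _ "Inc 0"]) (use step in \<open>auto simp: loader_def Suc_diff_Suc\<close>)
    with step.IH show ?case by (rule rtranclp.rtrancl_into_rtrancl)
  qed
  from this[of 0] have "(mstep (loader n))\<^sup>*\<^sup>* (2 * n, \<lambda>_. 0) (n, (\<lambda>_. 0)(0 := n))" by simp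
  moreover have "mstep (loader n) (n, s) (0, s)" for s
    by (rule mstep.intros[of _ Skip]) (auto simp: loader_def)
  ultimately show ?thesis by (meson rtranclp.rtrancl_into_rtrancl)
qed

text \<open>The edges \<open>E\<close> are obtained before \<open>n\<close> is quantified, as
  \<open>n\<close> will later be computed from them. The bound on the labels of \<open>E\<close>
  separates them from those of the loader, except for the jump to label 0.\<close>

lemma acceptor_machine:
  obtains E where "finite E" and
    "\<And>n s. \<forall>(p, i, q)\<in>E. p < n \<and> q < n \<Longrightarrow> 1 < n \<Longrightarrow>
      (mstep (E \<union> loader n))\<^sup>*\<^sup>* (2 * n, \<lambda>_. 0) (1, s) \<longleftrightarrow> computes f [n] 0 \<and> s = (\<lambda>_. 0)"
proof -
  obtain E n' where E: "implements E (acceptor f) 0 1 2 n'"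
    using ex_implements[of 0 2 1 "acceptor f"] by auto
  have "(mstep (E \<union> loader n))\<^sup>*\<^sup>* (2 * n, \<lambda>_. 0) (1, s) \<longleftrightarrow> computes f [n] 0 \<and> s = (\<lambda>_. 0)"
    if n: "\<forall>(p, i, q)\<in>E. p < n \<and> q < n" "1 < n" for n s
  proof
    assume "computes f [n] 0 \<and> s = (\<lambda>_. 0)"
    then have "(mstep E)\<^sup>*\<^sup>* (0, (\<lambda>_. 0)(0 := n)) (1, s)"
      using implements_complete[OF E] by (simp add: sem_acceptor)
    then have "(mstep (E \<union> loader n))\<^sup>*\<^sup>* (0, (\<lambda>_. 0)(0 := n)) (1, s)"
      by (rule msteps_mono) auto
    moreover have "(mstep (E \<union> loader n))\<^sup>*\<^sup>* (2 * n, \<lambda>_. 0) (0, (\<lambda>_. 0)(0 := n))"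
      using msteps_loader by (rule msteps_mono) auto
    ultimately show "(mstep (E \<union> loader n))\<^sup>*\<^sup>* (2 * n, \<lambda>_. 0) (1, s)" by simp
  next
    assume run: "(mstep (E \<union> loader n))\<^sup>*\<^sup>* (2 * n, \<lambda>_. 0) (1, s)"
    \<comment> \<open>Only entry and exit are specified; soundness of the implementation supplies
      the annotation of the inner labels.\<close>
    define A :: "nat \<Rightarrow> store \<Rightarrow> bool"
      where "A l s \<longleftrightarrow> (l = 0 \<longrightarrow> s = (\<lambda>_. 0)(0 := n)) \<and>
        (l = 1 \<longrightarrow> computes f [n] 0 \<and> s = (\<lambda>_. 0))" for l s
    have "\<forall>s s'. A 0 s \<longrightarrow> sem (acceptor f) s s' \<longrightarrow> A 1 s'"
      by (auto simp: A_def sem_acceptor)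
    from implements_sound[OF E, of A, OF this]
    obtain B where B: "\<forall>j. j \<notin> {2..<n'} \<longrightarrow> B j = A j" "inductive_annotation E B" .
    \<comment> \<open>Labels from \<open>n\<close> on are those of the loader, which counts down
      from \<open>2 * n\<close>: at label \<open>l\<close> it has performed \<open>2 * n - l\<close>
      increments, hence \<open>n\<close> of them when it leaves at label \<open>n\<close>.\<close>
    define C where "C l = (if l < n then B l else (\<lambda>s. s = (\<lambda>_. 0)(0 := 2 * n - l)))" for l
    have "inductive_annotation E C"
      using B(2) by (rule inductive_annotation_cong) (use n in \<open>auto simp: C_def\<close>)
    moreover have "C 0 = A 0" "C 1 = A 1" using n B by (auto simp: C_def)
    moreover have "inductive_annotation (loader n) C"
      using \<open>C 0 = A 0\<close>
      by (auto simp: inductive_annotation_def loader_def A_def) (auto simp: C_def fun_eq_iff)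
    ultimately have "inductive_annotation (E \<union> loader n) C"
      by (auto simp: inductive_annotation_def)
    moreover have "C (2 * n) (\<lambda>_. 0)"
      using n by (simp add: C_def) (rule ext, simp)
    ultimately have "C 1 s"
      using inductive_annotation_msteps run by blast
    with \<open>C 1 = A 1\<close> show "computes f [n] 0 \<and> s = (\<lambda>_. 0)" by (simp add: A_def)
  qed
  moreover have "finite E" using E by (simp add: implements_def)
  ultimately show ?thesis using that by blast
qed

section \<open>Steps of protocols\<close>

lemma step_internalI:
  "(q, Tau, q') \<in> trans P \<Longrightarrow> step P (add_mset q D) (add_mset q' D)"
  using step.internal[of q q' P "add_mset q D"] by simp

lemma step_rendez_vousI:
  "(q1, Send m, q1') \<in> trans P \<Longrightarrow> (q2, Recv m, q2') \<in> trans P \<Longrightarrow>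
    step P (add_mset q1 (add_mset q2 D)) (add_mset q1' (add_mset q2' D))"
  using step.rendez_vous[of q1 m q1' P q2 q2' "add_mset q1 (add_mset q2 D)"] by simp

lemma step_non_blockingI:
  "(q1, Send m, q1') \<in> trans P \<Longrightarrow> (\<And>q2 q2'. (q2, Recv m, q2') \<in> trans P \<Longrightarrow> q2 \<notin># D) \<Longrightarrow>
    step P (add_mset q1 D) (add_mset q1' D)"
  using step.non_blocking_request[of q1 m q1' P "add_mset q1 D"] by (simp add: not_in_iff)

lemma step_cases:
  assumes "step P C C'"
  obtains (internal) q q' D where "(q, Tau, q') \<in> trans P" "C = add_mset q D" "C' = add_mset q' D"
  | (rendez_vous) m q1 q1' q2 q2' D where
      "(q1, Send m, q1') \<in> trans P" "(q2, Recv m, q2') \<in> trans P"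
      "C = add_mset q1 (add_mset q2 D)" "C' = add_mset q1' (add_mset q2' D)"
  | (non_blocking) m q1 q1' D where "(q1, Send m, q1') \<in> trans P"
      "\<And>q2 q2'. (q2, Recv m, q2') \<in> trans P \<Longrightarrow> q2 \<notin># D"
      "C = add_mset q1 D" "C' = add_mset q1' D"
  using assms
proof cases
  case (internal q q')
  then show ?thesis using that(1)[of q q' "C - {#q#}"] by simp
next
  case (rendez_vous q1 m q1' q2 q2')
  obtain D where "C = {#q1, q2#} + D" using rendez_vous(4) by (auto simp: subset_mset.le_iff_add)
  then show ?thesis using that(2)[OF rendez_vous(2,3), of D] rendez_vous(1) by simp
next
  case (non_blocking_request q1 m q1')
  then show ?thesis using that(3)[of q1 m q1' "C - {#q1#}"] by (simp add: not_in_iff)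
qed

text \<open>Injectivity on states and messages is what transfers non-blocking requests: renaming
  must not create a new receiver. The form of the right-hand side shows that runs from a renamed
  configuration never leave the image of the renaming.\<close>

lemma step_image_mset:
  assumes "inj f" "inj g"
    and trans: "trans P' = (\<lambda>(q, a, q'). (f q, map_action g a, f q')) ` trans P"
  shows "step P' (image_mset f C) B \<longleftrightarrow> (\<exists>C'. B = image_mset f C' \<and> step P C C')"
proof -
  have tr: "(x, map_action g a, y) \<in> trans P' \<longleftrightarrow> (\<exists>q q'. x = f q \<and> y = f q' \<and> (q, a, q') \<in> trans P)" for x a y
    using inj_eq[OF action.inj_map[OF assms(2)]] by (auto simp: trans image_iff Bex_def)
  have tau: "(x, Tau, y) \<in> trans P' \<longleftrightarrow> (\<exists>q q'. x = f q \<and> y = f q' \<and> (q, Tau, q') \<in> trans P)" for x y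
    using tr[of _ Tau] by simp
  have send: "(x, Send m, y) \<in> trans P' \<longleftrightarrow>
      (\<exists>q q' m'. x = f q \<and> m = g m' \<and> y = f q' \<and> (q, Send m', q') \<in> trans P)" for x m y
  proof -
    have "Send m = map_action g a \<longleftrightarrow> (\<exists>m'. a = Send m' \<and> m = g m')" for a by (cases a) auto
    then show ?thesis by (auto simp: trans image_iff Bex_def)
  qed
  have recv: "(x, Recv (g m), y) \<in> trans P' \<longleftrightarrow>
      (\<exists>q q'. x = f q \<and> y = f q' \<and> (q, Recv m, q') \<in> trans P)" for x m y
    using tr[of _ "Recv m"] by simp
  have notin: "q \<notin># D" if "f q \<notin># image_mset f D" for q D using that by auto
  show ?thesis
  proof
    assume "step P' (image_mset f C) B"
    then show "\<exists>C'. B = image_mset f C' \<and> step P C C'"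
    proof (cases rule: step_cases)
      case (internal x y D)
      then obtain q q' where q: "x = f q" "y = f q'" "(q, Tau, q') \<in> trans P" by (auto simp: tau)
      obtain p D' where "C = add_mset p D'" "f p = x" "image_mset f D' = D"
        using internal(2) by (auto dest!: msed_map_invR)
      then show ?thesis
        using q internal(3) inj_eq[OF assms(1)] step_internalI[OF q(3), of D']
        by (intro exI[of _ "add_mset q' D'"]) auto
    next
      case (rendez_vous m x1 y1 x2 y2 D)
      from rendez_vous(1) obtain q1 q1' m' where q1: "x1 = f q1" "m = g m'" "y1 = f q1'"
        "(q1, Send m', q1') \<in> trans P" by (auto simp: send)
      with rendez_vous(2) obtain q2 q2' where q2: "x2 = f q2" "y2 = f q2'"
        "(q2, Recv m', q2') \<in> trans P" by (auto simp: recv)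
      obtain p D' where D': "C = add_mset p D'" "f p = x1" "image_mset f D' = add_mset x2 D"
        using rendez_vous(3) by (auto dest!: msed_map_invR)
      then obtain p' D'' where "D' = add_mset p' D''" "f p' = x2" "image_mset f D'' = D"
        by (auto dest!: msed_map_invR)
      with D' show ?thesis
        using q1 q2 rendez_vous(4) inj_eq[OF assms(1)] step_rendez_vousI[OF q1(4) q2(3), of D'']
        by (intro exI[of _ "add_mset q1' (add_mset q2' D'')"]) auto
    next
      case (non_blocking m x1 y1 D)
      from non_blocking(1) obtain q1 q1' m' where q1: "x1 = f q1" "m = g m'" "y1 = f q1'"
        "(q1, Send m', q1') \<in> trans P" by (auto simp: send)
      obtain p D' where D': "C = add_mset p D'" "f p = x1" "image_mset f D' = D"
        using non_blocking(3) by (auto dest!: msed_map_invR)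
      have "step P (add_mset q1 D') (add_mset q1' D')"
        by (rule step_non_blockingI[OF q1(4)])
          (use non_blocking(2) recv q1(2) D'(3) notin in blast)
      then show ?thesis
        using q1 D' non_blocking(4) inj_eq[OF assms(1)]
        by (intro exI[of _ "add_mset q1' D'"]) auto
    qed
  next
    assume "\<exists>C'. B = image_mset f C' \<and> step P C C'"
    then obtain C' where B: "B = image_mset f C'" and "step P C C'" by blast
    from this(2) show "step P' (image_mset f C) B"
    proof (cases rule: step_cases)
      case (internal q q' D)
      then have "(f q, Tau, f q') \<in> trans P'" by (auto simp: tau)
      from step_internalI[OF this] show ?thesis using internal B by simp
    next
      case (rendez_vous m q1 q1' q2 q2' D)
      then have "(f q1, Send (g m), f q1') \<in> trans P'" "(f q2, Recv (g m), f q2') \<in> trans P'"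
        by (auto simp: send recv)
      from step_rendez_vousI[OF this] show ?thesis using rendez_vous B by simp
    next
      case (non_blocking m q1 q1' D)
      then have "(f q1, Send (g m), f q1') \<in> trans P'" by (auto simp: send)
      moreover have "x2 \<notin># image_mset f D" if "(x2, Recv (g m), y2) \<in> trans P'" for x2 y2
        using that non_blocking(2) inj_eq[OF assms(1)] by (auto simp: recv)
      ultimately show ?thesis
        using step_non_blockingI[of "f q1" "g m" "f q1'" P' "image_mset f D"] non_blocking(3,4) B by simp
    qed
  qed
qed

lemma steps_image_mset:
  assumes "inj f" "inj g"
    and trans: "trans P' = (\<lambda>(q, a, q'). (f q, map_action g a, f q')) ` trans P"
  shows "(step P')\<^sup>*\<^sup>* (image_mset f C) (image_mset f C') \<longleftrightarrow> (step P)\<^sup>*\<^sup>* C C'"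
proof
  assume "(step P')\<^sup>*\<^sup>* (image_mset f C) (image_mset f C')"
  then have "\<exists>D. image_mset f C' = image_mset f D \<and> (step P)\<^sup>*\<^sup>* C D"
  proof (induction rule: rtranclp_induct)
    case (step B B')
    then show ?case
      using step_image_mset[OF assms] by (metis rtranclp.rtrancl_into_rtrancl)
  qed blast
  then show "(step P)\<^sup>*\<^sup>* C C'"
    using multiset.inj_map[OF assms(1)] by (auto dest: injD)
next
  assume "(step P)\<^sup>*\<^sup>* C C'"
  then show "(step P')\<^sup>*\<^sup>* (image_mset f C) (image_mset f C')"
  proof (induction rule: rtranclp_induct)
    case (step D D')
    then show ?case
      using step_image_mset[OF assms] by (metis rtranclp.rtrancl_into_rtrancl)
  qed simp
qed

lemma concentrated_iff_replicate_mset: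
  assumes "p \<in> S"
  shows "C \<noteq> {#} \<and> set_mset C \<subseteq> S \<and> (\<forall>q. q \<noteq> p \<longrightarrow> count C q = 0) \<longleftrightarrow>
    (\<exists>k. C = replicate_mset (Suc k) p)"
proof
  assume C: "C \<noteq> {#} \<and> set_mset C \<subseteq> S \<and> (\<forall>q. q \<noteq> p \<longrightarrow> count C q = 0)"
  then have "C = replicate_mset (size C) p"
    by (intro set_mset_subset_singletonD) (auto simp flip: not_in_iff)
  with C show "\<exists>k. C = replicate_mset (Suc k) p" by (metis nonempty_has_size gr0_conv_Suc)
qed (use assms in \<open>auto split: if_splits\<close>)

text \<open>Eliminates the state set in favour of the two distinguished states, so that protocols
  with different state sets can be compared by their runs.\<close>

lemma synchro_iff:
  assumes "q_init P \<in> states P" "q_final P \<in> states P"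
  shows "synchro P \<longleftrightarrow> (\<exists>k j. (step P)\<^sup>*\<^sup>* (replicate_mset (Suc k) (q_init P))
    (replicate_mset (Suc j) (q_final P)))"
  unfolding synchro_def initial_configuration_def final_configuration_def configuration_def conj_assoc
    concentrated_iff_replicate_mset[OF assms(1)] concentrated_iff_replicate_mset[OF assms(2)]
  by blast

section \<open>Simulation of counter machines by wait-only protocols\<close>

text \<open>\<open>Up i\<close> and \<open>Down i\<close> are the halves of a handshake: the process
  has heard an increment or decrement of counter \<open>i\<close> and still has to acknowledge it.
  \<open>Idle\<close> is the reservoir from which tokens are made.\<close>

datatype st =
    Start | Final | Candidate | Guard | Idle | Sink
  | Active nat | Waiting nat
  | Token nat | Up nat | Down nat

datatype msg = Lead | Go | Finish | Ack | MInc nat | MDec nat | MZero nat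

type_synonym transition = "st \<times> msg action \<times> st"

text \<open>
  A candidate or guard that hears \<open>Lead\<close> becomes a sink. Since the candidate becomes leader only
  by hearing a process turn into a guard, there is at most one leader. Final processes hear \<open>Lead\<close>
  as well because the guard is released by \<open>Finish\<close>, the last request of the leader.
\<close>
definition base_trans :: "nat \<Rightarrow> transition set" where
  "base_trans r =
    {(Start, Send Lead, Candidate), (Candidate, Recv Lead, Sink), (Guard, Recv Lead, Sink),
     (Final, Recv Lead, Sink), (Start, Send Go, Guard), (Start, Tau, Idle),
     (Active 1, Send Finish, Final), (Guard, Recv Finish, Final)} \<union>
    (\<Union>i<r.
      {(Idle, Recv (MInc i), Up i), (Up i, Send Ack, Token i),
       (Token i, Recv (MDec i), Down i), (Down i, Send Ack, Final),
       (Token i, Recv (MZero i), Sink)})"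

text \<open>The target label is remembered in the waiting state, so a single message
  \<open>Ack\<close> serves all edges. A zero test goes without acknowledgement, since its success
  is precisely that nobody hears it.\<close>

fun edge_trans :: "edge \<Rightarrow> transition set" where
  "edge_trans (l, Inc i, l') = {(Active l, Send (MInc i), Waiting l'), (Waiting l', Recv Ack, Active l')}"
| "edge_trans (l, Dec i, l') = {(Active l, Send (MDec i), Waiting l'), (Waiting l', Recv Ack, Active l')}"
| "edge_trans (l, IsZero i, l') = {(Active l, Send (MZero i), Active l')}"
| "edge_trans (l, Skip, l') = {(Active l, Tau, Active l')}"

definition machine_trans :: "nat \<Rightarrow> edge set \<Rightarrow> nat \<Rightarrow> transition set" where
  "machine_trans r E l0 =
    base_trans r \<union> insert (Candidate, Recv Go, Active l0) (\<Union> (edge_trans ` E))"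

text \<open>An intermediate object with readable names and an infinite state set; finiteness comes
  with the renamed \<open>loaded_protocol\<close>.\<close>

definition machine_protocol :: "nat \<Rightarrow> edge set \<Rightarrow> nat \<Rightarrow> (st, msg) protocol" where
  "machine_protocol r E l0 =
    \<lparr>states = UNIV, alphabet = UNIV, q_init = Start, q_final = Final, trans = machine_trans r E l0\<rparr>"

fun register :: "instr \<Rightarrow> nat set" where
  "register (Inc i) = {i}"
| "register (Dec i) = {i}"
| "register (IsZero i) = {i}"
| "register Skip = {}"

text \<open>The candidate, the leader and its partner in an unfinished handshake: the processes
  whose exact number the invariant controls.\<close>

fun is_core :: "st \<Rightarrow> bool" where
  "is_core Candidate = True"
| "is_core (Active l) = True"
| "is_core (Waiting l) = True"
| "is_core (Up i) = True"
| "is_core (Down i) = True"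
| "is_core _ = False"

definition core :: "st multiset \<Rightarrow> st multiset" where
  "core = filter_mset is_core"

lemma core_add_mset [simp]:
  "core (add_mset q C) = (if is_core q then add_mset q (core C) else core C)"
  by (simp add: core_def)

lemma core_memberD:
  assumes "core C = add_mset q M"
  shows "q \<in># C"
proof -
  have "q \<in># core C" by (simp add: assms)
  then show ?thesis by (simp add: core_def)
qed

definition tokens :: "st multiset \<Rightarrow> store" where
  "tokens C = (\<lambda>i. count C (Token i))"

lemma tokens_add_mset [simp]:
  "tokens (add_mset q C) =
    (case q of Token i \<Rightarrow> (tokens C)(i := Suc (tokens C i)) | _ \<Rightarrow> tokens C)"
  by (auto simp: tokens_def fun_eq_iff split: st.split)

lemma tokens_eq_0_iff: "tokens C i = 0 \<longleftrightarrow> Token i \<notin># C"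
  by (simp add: tokens_def not_in_iff)

lemma add_mset_eq_pair_iff [simp]:
  "add_mset x M = {#y, z#} \<longleftrightarrow> x = y \<and> M = {#z#} \<or> x = z \<and> M = {#y#}"
  by (auto simp: add_eq_conv_ex)

locale machine =
  fixes r :: nat and E :: "edge set" and l0 :: nat
  assumes register: "(l, i, l') \<in> E \<Longrightarrow> register i \<subseteq> {..<r}"
begin

abbreviation P where "P \<equiv> machine_protocol r E l0"

lemma edge_trans_iff:
  "(q, a, q') \<in> \<Union> (edge_trans ` E) \<longleftrightarrow>
    (\<exists>l l'. (l, Skip, l') \<in> E \<and> q = Active l \<and> a = Tau \<and> q' = Active l') \<or>
    (\<exists>l l' i. (l, Inc i, l') \<in> E \<and> q = Active l \<and> a = Send (MInc i) \<and> q' = Waiting l') \<or>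
    (\<exists>l l' i. (l, Dec i, l') \<in> E \<and> q = Active l \<and> a = Send (MDec i) \<and> q' = Waiting l') \<or>
    (\<exists>l l' i. (l, IsZero i, l') \<in> E \<and> q = Active l \<and> a = Send (MZero i) \<and> q' = Active l') \<or>
    (\<exists>l l' i. ((l, Inc i, l') \<in> E \<or> (l, Dec i, l') \<in> E) \<and> q = Waiting l' \<and> a = Recv Ack \<and> q' = Active l')"
  (is "?L \<longleftrightarrow> ?R")
proof
  assume ?L
  then obtain l i l' where e: "(l, i, l') \<in> E" "(q, a, q') \<in> edge_trans (l, i, l')" by auto
  then show ?R by (cases i) auto
next
  assume ?R
  then show ?L by (elim disjE exE conjE) (force intro: UN_I)+
qed

lemma in_trans:
  "(q, Tau, q') \<in> trans P \<longleftrightarrow> q = Start \<and> q' = Idle \<or>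
    (\<exists>l l'. (l, Skip, l') \<in> E \<and> q = Active l \<and> q' = Active l')"
  "(q, Send Lead, q') \<in> trans P \<longleftrightarrow> q = Start \<and> q' = Candidate"
  "(q, Send Go, q') \<in> trans P \<longleftrightarrow> q = Start \<and> q' = Guard"
  "(q, Send Finish, q') \<in> trans P \<longleftrightarrow> q = Active 1 \<and> q' = Final"
  "(q, Send Ack, q') \<in> trans P \<longleftrightarrow> (\<exists>i<r. q = Up i \<and> q' = Token i \<or> q = Down i \<and> q' = Final)"
  "(q, Send (MInc i), q') \<in> trans P \<longleftrightarrow>
    (\<exists>l l'. (l, Inc i, l') \<in> E \<and> q = Active l \<and> q' = Waiting l')"
  "(q, Send (MDec i), q') \<in> trans P \<longleftrightarrow>
    (\<exists>l l'. (l, Dec i, l') \<in> E \<and> q = Active l \<and> q' = Waiting l')"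
  "(q, Send (MZero i), q') \<in> trans P \<longleftrightarrow>
    (\<exists>l l'. (l, IsZero i, l') \<in> E \<and> q = Active l \<and> q' = Active l')"
  "(q, Recv Lead, q') \<in> trans P \<longleftrightarrow> (q = Candidate \<or> q = Guard \<or> q = Final) \<and> q' = Sink"
  "(q, Recv Go, q') \<in> trans P \<longleftrightarrow> q = Candidate \<and> q' = Active l0"
  "(q, Recv Finish, q') \<in> trans P \<longleftrightarrow> q = Guard \<and> q' = Final"
  "(q, Recv Ack, q') \<in> trans P \<longleftrightarrow>
    (\<exists>l l' i. ((l, Inc i, l') \<in> E \<or> (l, Dec i, l') \<in> E) \<and> q = Waiting l' \<and> q' = Active l')"
  "(q, Recv (MInc i), q') \<in> trans P \<longleftrightarrow> i < r \<and> q = Idle \<and> q' = Up i"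
  "(q, Recv (MDec i), q') \<in> trans P \<longleftrightarrow> i < r \<and> q = Token i \<and> q' = Down i"
  "(q, Recv (MZero i), q') \<in> trans P \<longleftrightarrow> i < r \<and> q = Token i \<and> q' = Sink"
  by (auto simp: machine_protocol_def machine_trans_def base_trans_def edge_trans_iff
      simp del: Union_iff UN_iff UN_simps)

definition reach :: "nat \<Rightarrow> store \<Rightarrow> bool" where
  "reach l s \<longleftrightarrow> (mstep E)\<^sup>*\<^sup>* (l0, \<lambda>_. 0) (l, s)"

lemma reach_initial: "\<forall>i. Token i \<notin># C \<Longrightarrow> reach l0 (tokens C)"
proof -
  assume "\<forall>i. Token i \<notin># C"
  then have "tokens C = (\<lambda>_. 0)" by (simp add: fun_eq_iff tokens_eq_0_iff)
  then show ?thesis by (simp add: reach_def)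
qed

lemma reach_step: "reach l s \<Longrightarrow> (l, i, l') \<in> E \<Longrightarrow> exec i s s' \<Longrightarrow> reach l' s'"
  unfolding reach_def by (meson mstep.intros rtranclp.rtrancl_into_rtrancl)

lemma reach_Inc: "reach l s \<Longrightarrow> (l, Inc i, l') \<in> E \<Longrightarrow> reach l' (s(i := Suc (s i)))"
  by (rule reach_step) auto

lemma reach_Dec: "reach l (s(i := Suc (s i))) \<Longrightarrow> (l, Dec i, l') \<in> E \<Longrightarrow> reach l' s"
  by (rule reach_step) auto

lemma reach_IsZero: "reach l s \<Longrightarrow> (l, IsZero i, l') \<in> E \<Longrightarrow> s i = 0 \<Longrightarrow> reach l' s"
  by (rule reach_step) auto

lemma reach_Skip: "reach l s \<Longrightarrow> (l, Skip, l') \<in> E \<Longrightarrow> reach l' s"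
  by (rule reach_step) auto

section \<open>Soundness: synchronizing runs simulate the machine\<close>

definition leaderless :: "st multiset \<Rightarrow> bool" where
  "leaderless C \<longleftrightarrow> core C = {#} \<and> Final \<notin># C \<and> (\<forall>i. Token i \<notin># C)"

definition candidacy :: "st multiset \<Rightarrow> bool" where
  "candidacy C \<longleftrightarrow> core C = {#Candidate#} \<and> Guard \<notin># C \<and> Final \<notin># C \<and> (\<forall>i. Token i \<notin># C)"

text \<open>
  As long as a guard or a final process is around, no second leader can be elected without
  creating a sink process. A leader whose request was not received stays waiting for ever,
  which is why nothing is claimed in that case.
\<close>
definition simulating :: "st multiset \<Rightarrow> bool" where
  "simulating C \<longleftrightarrow> (Guard \<in># C \<or> Final \<in># C) \<and>
    ((\<exists>l. core C = {#Active l#} \<and> reach l (tokens C)) \<or>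
     (\<exists>l. core C = {#Waiting l#}) \<or>
     (\<exists>l i. core C = {#Waiting l, Up i#} \<and> reach l ((tokens C)(i := Suc (tokens C i)))) \<or>
     (\<exists>l i. core C = {#Waiting l, Down i#} \<and> reach l (tokens C)))"

text \<open>The first two disjuncts are absorbing: a sink never disappears, and reachability of
  label 1 is the goal itself. So nothing has to be tracked after a sink has appeared or after the
  leader is able to send \<open>Finish\<close>.\<close>

definition invariant :: "st multiset \<Rightarrow> bool" where
  "invariant C \<longleftrightarrow> Sink \<in># C \<or> (\<exists>s. reach 1 s) \<or> leaderless C \<or> candidacy C \<or> simulating C"

lemma no_trans_Sink: "(Sink, a, q) \<notin> trans P"
  by (auto simp: machine_protocol_def machine_trans_def base_trans_def edge_trans_iff
      simp del: Union_iff UN_iff UN_simps)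

lemmas phase_defs = leaderless_def candidacy_def simulating_def

lemma invariant_internal:
  assumes "(q, Tau, q') \<in> trans P" "leaderless (add_mset q D) \<or> candidacy (add_mset q D) \<or> simulating (add_mset q D)"
  shows "invariant (add_mset q' D)"
  using assms(1) unfolding in_trans
proof (elim disjE exE conjE)
  assume "q = Start" "q' = Idle"
  with assms(2) show ?thesis by (simp add: phase_defs invariant_def)
next
  fix l l' assume e: "(l, Skip, l') \<in> E" "q = Active l" "q' = Active l'"
  with assms(2) have "reach l (tokens D)" "core D = {#}" "Guard \<in># D \<or> Final \<in># D"
    by (auto simp: phase_defs)
  with e reach_Skip have "simulating (add_mset q' D)"
    by (simp add: simulating_def)
  then show ?thesis by (simp add: invariant_def)
qed

text \<open>That nobody hears \<open>Lead\<close> certifies the absence of candidates, guards and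
  final processes. This rules out an election in progress and a working leader, so the new candidate
  is the only one.\<close>

lemma invariant_Lead:
  assumes "(q1, Send Lead, q1') \<in> trans P" "\<And>q2 q2'. (q2, Recv Lead, q2') \<in> trans P \<Longrightarrow> q2 \<notin># D"
    "leaderless (add_mset q1 D) \<or> candidacy (add_mset q1 D) \<or> simulating (add_mset q1 D)"
  shows "invariant (add_mset q1' D)"
proof -
  have D: "Candidate \<notin># D" "Guard \<notin># D" "Final \<notin># D"
    using assms(2)[of Candidate Sink] assms(2)[of Guard Sink] assms(2)[of Final Sink]
    by (simp_all add: in_trans)
  have q: "q1 = Start" "q1' = Candidate" using assms(1) by (simp_all add: in_trans)
  have "core D \<noteq> {#Candidate#}" using core_memberD D(1) by blast
  moreover have "\<not> simulating (add_mset q1 D)" using D by (simp add: simulating_def q)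
  ultimately have "candidacy (add_mset q1' D)"
    using assms(3) D by (simp add: leaderless_def candidacy_def q)
  then show ?thesis by (simp add: invariant_def)
qed

text \<open>That nobody hears \<open>Go\<close> certifies the absence of a candidate. In the two
  remaining phases an additional guard does no harm, as their definitions put no upper bound on
  guards.\<close>

lemma invariant_Go:
  assumes "(q1, Send Go, q1') \<in> trans P" "\<And>q2 q2'. (q2, Recv Go, q2') \<in> trans P \<Longrightarrow> q2 \<notin># D"
    "leaderless (add_mset q1 D) \<or> candidacy (add_mset q1 D) \<or> simulating (add_mset q1 D)"
  shows "invariant (add_mset q1' D)"
proof -
  have D: "Candidate \<notin># D" using assms(2)[of Candidate "Active l0"] by (simp add: in_trans)
  have q: "q1 = Start" "q1' = Guard" using assms(1) by (simp_all add: in_trans)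
  have "\<not> candidacy (add_mset q1 D)" using core_memberD D(1) by (auto simp: candidacy_def q)
  then have "leaderless (add_mset q1' D) \<or> simulating (add_mset q1' D)"
    using assms(3) by (auto simp: leaderless_def simulating_def q)
  then show ?thesis by (auto simp: invariant_def)
qed

lemma invariant_non_blocking:
  assumes "(q1, Send m, q1') \<in> trans P" "\<And>q2 q2'. (q2, Recv m, q2') \<in> trans P \<Longrightarrow> q2 \<notin># D"
    "leaderless (add_mset q1 D) \<or> candidacy (add_mset q1 D) \<or> simulating (add_mset q1 D)"
  shows "invariant (add_mset q1' D)"
proof (cases m)
  case Lead
  then show ?thesis using invariant_Lead assms by blast
next
  case Go
  then show ?thesis using invariant_Go assms by blast
next
  case Finish
  then show ?thesis using assms(1,3) by (auto simp: in_trans phase_defs invariant_def)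
next
  case Ack
  \<comment> \<open>The invariant does not record that \<open>Waiting l\<close> has a receiving
    transition, so a lost acknowledgement is not contradictory here; the phase with a lone waiting
    leader absorbs it.\<close>
  then obtain i where q: "q1 = Up i \<and> q1' = Token i \<or> q1 = Down i \<and> q1' = Final"
    using assms(1) by (auto simp: in_trans)
  then have "Guard \<in># D \<or> Final \<in># D" "\<exists>l. core D = {#Waiting l#}"
    using assms(3) by (auto simp: phase_defs)
  with q have "simulating (add_mset q1' D)" by (auto simp: simulating_def)
  then show ?thesis by (simp add: invariant_def)
next
  case (MInc i)
  then obtain l l' where q: "q1 = Active l" "q1' = Waiting l'"
    using assms(1) by (auto simp: in_trans)
  then have "core D = {#}" "Guard \<in># D \<or> Final \<in># D"
    using assms(3) by (auto simp: phase_defs)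
  then have "simulating (add_mset q1' D)" by (simp add: simulating_def q)
  then show ?thesis by (simp add: invariant_def)
next
  case (MDec i)
  then obtain l l' where q: "q1 = Active l" "q1' = Waiting l'"
    using assms(1) by (auto simp: in_trans)
  then have "core D = {#}" "Guard \<in># D \<or> Final \<in># D"
    using assms(3) by (auto simp: phase_defs)
  then have "simulating (add_mset q1' D)" by (simp add: simulating_def q)
  then show ?thesis by (simp add: invariant_def)
next
  case (MZero i)
  from assms(1) obtain l l' where e: "(l, IsZero i, l') \<in> E" "q1 = Active l" "q1' = Active l'"
    by (auto simp: MZero in_trans)
  \<comment> \<open>Tokens of registers below \<open>r\<close> can hear the zero test, so silence
    means that the counter is zero.\<close>
  then have "i < r" using register[OF e(1)] by simp
  then have "tokens D i = 0"
    using assms(2) by (auto simp: MZero in_trans tokens_eq_0_iff)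
  moreover have "reach l (tokens D)" "core D = {#}" "Guard \<in># D \<or> Final \<in># D"
    using assms(3) by (auto simp: phase_defs e)
  ultimately have "simulating (add_mset q1' D)"
    using e reach_IsZero by (simp add: simulating_def)
  then show ?thesis by (simp add: invariant_def)
qed

lemma invariant_rendez_vous:
  assumes "(q1, Send m, q1') \<in> trans P" "(q2, Recv m, q2') \<in> trans P"
    "C = add_mset q1 (add_mset q2 D)"
    "leaderless C \<or> candidacy C \<or> simulating C"
  shows "invariant (add_mset q1' (add_mset q2' D))"
proof (cases m)
  case Lead
  then show ?thesis using assms by (auto simp: in_trans invariant_def)
next
  case Go
  then have q: "q1 = Start" "q1' = Guard" "q2 = Candidate" "q2' = Active l0"
    using assms(1,2) by (auto simp: in_trans)
  then have "core D = {#}" "\<forall>i. Token i \<notin># D"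
    using assms(3,4) by (auto simp: phase_defs)
  then have "simulating (add_mset q1' (add_mset q2' D))"
    using reach_initial by (simp add: simulating_def q)
  then show ?thesis by (simp add: invariant_def)
next
  case Finish
  then have "q1 = Active 1" using assms(1) by (simp add: in_trans)
  then have "\<exists>s. reach 1 s" using assms(3,4) by (auto simp: phase_defs)
  then show ?thesis by (simp add: invariant_def)
next
  case Ack
  then obtain i l where q1: "q1 = Up i \<and> q1' = Token i \<or> q1 = Down i \<and> q1' = Final"
    and q2: "q2 = Waiting l" "q2' = Active l"
    using assms(1,2) by (auto simp: in_trans)
  then have D: "core D = {#}" "Guard \<in># D \<or> Final \<in># D"
    using assms(3,4) by (auto simp: phase_defs)
  \<comment> \<open>With \<open>Up i\<close> the invariant already speaks of the store including the
    pending token, with \<open>Down i\<close> of the store without the removed one. The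
    acknowledgement makes the tokens agree with it.\<close>
  have "reach l (tokens (add_mset q1' D))"
    using q1 q2 assms(3,4) by (auto simp: phase_defs)
  then have "simulating (add_mset q1' (add_mset q2' D))"
    using q1 D by (auto simp: simulating_def q2)
  then show ?thesis by (simp add: invariant_def)
next
  case (MInc i)
  then obtain l l' where e: "(l, Inc i, l') \<in> E" and q: "q1 = Active l" "q1' = Waiting l'"
      "q2 = Idle" "q2' = Up i"
    using assms(1,2) by (auto simp: in_trans)
  then have "core D = {#}" "Guard \<in># D \<or> Final \<in># D" "reach l (tokens D)"
    using assms(3,4) by (auto simp: phase_defs)
  then have "simulating (add_mset q1' (add_mset q2' D))"
    using reach_Inc[OF _ e] by (simp add: simulating_def q)
  then show ?thesis by (simp add: invariant_def)
next
  case (MDec i)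
  then obtain l l' where e: "(l, Dec i, l') \<in> E" and q: "q1 = Active l" "q1' = Waiting l'"
      "q2 = Token i" "q2' = Down i"
    using assms(1,2) by (auto simp: in_trans)
  then have "core D = {#}" "Guard \<in># D \<or> Final \<in># D" "reach l ((tokens D)(i := Suc (tokens D i)))"
    using assms(3,4) by (auto simp: phase_defs)
  then have "simulating (add_mset q1' (add_mset q2' D))"
    using reach_Dec[OF _ e] by (simp add: simulating_def q)
  then show ?thesis by (simp add: invariant_def)
next
  case (MZero i)
  then have "q2' = Sink" using assms(2) by (auto simp: in_trans)
  then show ?thesis by (simp add: invariant_def)
qed

lemma invariant_step:
  assumes "step P C C'" "invariant C"
  shows "invariant C'"
proof (cases "Sink \<in># C \<or> (\<exists>s. reach 1 s)")
  case True
  from assms(1) no_trans_Sink have "Sink \<in># C \<Longrightarrow> Sink \<in># C'"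
    by (cases rule: step_cases) auto
  with True show ?thesis by (auto simp: invariant_def)
next
  case False
  with assms(2) have "leaderless C \<or> candidacy C \<or> simulating C" by (auto simp: invariant_def)
  with assms(1) show ?thesis
    by (cases rule: step_cases)
      (blast intro: invariant_internal invariant_non_blocking invariant_rendez_vous)+
qed

text \<open>A configuration with all processes in \<open>Final\<close> has no sink and an empty
  core, yet it contains \<open>Final\<close>. This contradicts every phase of the invariant, so only
  reachability of label 1 remains.\<close>

lemma reach_if_synchro:
  assumes "(step P)\<^sup>*\<^sup>* (replicate_mset k Start) (replicate_mset (Suc j) Final)"
  shows "\<exists>s. reach 1 s"
proof -
  have "invariant (replicate_mset k Start)"
  proof -
    have "core (replicate_mset k Start) = {#}" by (simp add: core_def)
    then show ?thesis by (auto simp: invariant_def leaderless_def)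
  qed
  with assms have "invariant (replicate_mset (Suc j) Final)"
    by (induction rule: rtranclp_induct) (auto intro: invariant_step)
  moreover have "core (replicate_mset j Final) = {#}" by (simp add: core_def)
  ultimately show ?thesis
    by (auto simp: invariant_def leaderless_def candidacy_def simulating_def split: if_splits)
qed

section \<open>Completeness: accepting runs yield synchronization\<close>

lemma step_Ack:
  assumes "(l, Inc i, l') \<in> E \<or> (l, Dec i, l') \<in> E" "(q, Send Ack, q') \<in> trans P"
  shows "step P (add_mset q (add_mset (Waiting l') D)) (add_mset q' (add_mset (Active l') D))"
  using assms by (intro step_rendez_vousI[where m = Ack]) (auto simp: in_trans)

lemma steps_Inc:
  assumes "(l, Inc i, l') \<in> E"
  shows "(step P)\<^sup>*\<^sup>* (add_mset (Active l) (add_mset Idle D)) (add_mset (Active l') (add_mset (Token i) D))"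
proof -
  have "i < r" using register[OF assms] by simp
  then have "step P (add_mset (Active l) (add_mset Idle D)) (add_mset (Waiting l') (add_mset (Up i) D))"
    using assms by (intro step_rendez_vousI[where m = "MInc i"]) (auto simp: in_trans)
  moreover have "step P (add_mset (Up i) (add_mset (Waiting l') D)) (add_mset (Token i) (add_mset (Active l') D))"
    using assms \<open>i < r\<close> by (intro step_Ack) (auto simp: in_trans)
  ultimately show ?thesis
    by (simp add: add_mset_commute converse_rtranclp_into_rtranclp r_into_rtranclp)
qed

lemma steps_Dec:
  assumes "(l, Dec i, l') \<in> E"
  shows "(step P)\<^sup>*\<^sup>* (add_mset (Active l) (add_mset (Token i) D)) (add_mset (Active l') (add_mset Final D))"
proof -
  have "i < r" using register[OF assms] by simp
  then have "step P (add_mset (Active l) (add_mset (Token i) D)) (add_mset (Waiting l') (add_mset (Down i) D))"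
    using assms by (intro step_rendez_vousI[where m = "MDec i"]) (auto simp: in_trans)
  moreover have "step P (add_mset (Down i) (add_mset (Waiting l') D)) (add_mset Final (add_mset (Active l') D))"
    using assms \<open>i < r\<close> by (intro step_Ack) (auto simp: in_trans)
  ultimately show ?thesis
    by (simp add: add_mset_commute converse_rtranclp_into_rtranclp r_into_rtranclp)
qed

text \<open>The number \<open>k\<close> counts the increments of the run: each consumes one idle
  process, so none is left over at the end. Decremented tokens become final, whence the number of
  final processes varies and \<open>D\<close> is quantified after \<open>k\<close>.\<close>

lemma simulate_run:
  assumes "(mstep E)\<^sup>*\<^sup>* (l, s) (l', \<lambda>_. 0)"
  shows "\<exists>k. \<forall>D. set_mset D \<subseteq> {Idle, Final} \<union> range Token \<longrightarrow> count D Idle = k \<longrightarrow> tokens D = s \<longrightarrow>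
    (\<exists>j. (step P)\<^sup>*\<^sup>* (add_mset (Active l) (add_mset Guard D))
      (add_mset (Active l') (add_mset Guard (replicate_mset j Final))))"
  using assms
proof (induction rule: converse_rtranclp_induct2)
  case refl
  show ?case
  proof (rule exI[of _ 0], intro allI impI)
    fix D assume D: "set_mset D \<subseteq> {Idle, Final} \<union> range Token" "count D Idle = 0" "tokens D = (\<lambda>_. 0)"
    then have "Idle \<notin># D" "\<forall>i. Token i \<notin># D"
      by (auto simp: not_in_iff tokens_def fun_eq_iff)
    with D(1) have "set_mset D \<subseteq> {Final}" by auto
    then have "D = replicate_mset (size D) Final" by (rule set_mset_subset_singletonD)
    then show "\<exists>j. (step P)\<^sup>*\<^sup>* (add_mset (Active l') (add_mset Guard D))
        (add_mset (Active l') (add_mset Guard (replicate_mset j Final)))"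
      by (metis rtranclp.rtrancl_refl)
  qed
next
  case (step l s m t)
  from step.IH obtain k where IH: "\<And>D. set_mset D \<subseteq> {Idle, Final} \<union> range Token \<Longrightarrow> count D Idle = k \<Longrightarrow>
      tokens D = t \<Longrightarrow> \<exists>j. (step P)\<^sup>*\<^sup>* (add_mset (Active m) (add_mset Guard D))
      (add_mset (Active l') (add_mset Guard (replicate_mset j Final)))" by blast
  from step.hyps(1) obtain i where i: "(l, i, m) \<in> E" "exec i s t" by (auto elim: mstep.cases)
  have *: "\<exists>k'. \<forall>D. set_mset D \<subseteq> {Idle, Final} \<union> range Token \<longrightarrow> count D Idle = k' \<longrightarrow> tokens D = s \<longrightarrow>
    (\<exists>D'. set_mset D' \<subseteq> {Idle, Final} \<union> range Token \<and> count D' Idle = k \<and> tokens D' = t \<and>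
      (step P)\<^sup>*\<^sup>* (add_mset (Active l) (add_mset Guard D)) (add_mset (Active m) (add_mset Guard D')))"
  proof (cases i)
    case (Inc c)
    show ?thesis
    proof (intro exI[of _ "Suc k"] allI impI)
      fix D assume D: "set_mset D \<subseteq> {Idle, Final} \<union> range Token" "count D Idle = Suc k" "tokens D = s"
      then have "Idle \<in># D" by (metis not_in_iff nat.distinct(2))
      then obtain D' where D': "D = add_mset Idle D'" by (blast dest: multi_member_split)
      then show "\<exists>D'. set_mset D' \<subseteq> {Idle, Final} \<union> range Token \<and> count D' Idle = k \<and> tokens D' = t \<and>
          (step P)\<^sup>*\<^sup>* (add_mset (Active l) (add_mset Guard D)) (add_mset (Active m) (add_mset Guard D'))"
        using D i steps_Inc[of l c m "add_mset Guard D'"]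
        by (intro exI[of _ "add_mset (Token c) D'"]) (auto simp: Inc add_mset_commute)
    qed
  next
    case (Dec c)
    show ?thesis
    proof (intro exI[of _ k] allI impI)
      fix D assume D: "set_mset D \<subseteq> {Idle, Final} \<union> range Token" "count D Idle = k" "tokens D = s"
      then have "Token c \<in># D" using i by (simp add: Dec) (metis tokens_eq_0_iff less_numeral_extra(3))
      then obtain D' where D': "D = add_mset (Token c) D'" by (blast dest: multi_member_split)
      then show "\<exists>D'. set_mset D' \<subseteq> {Idle, Final} \<union> range Token \<and> count D' Idle = k \<and> tokens D' = t \<and>
          (step P)\<^sup>*\<^sup>* (add_mset (Active l) (add_mset Guard D)) (add_mset (Active m) (add_mset Guard D'))"
        using D i steps_Dec[of l c m "add_mset Guard D'"]
        by (intro exI[of _ "add_mset Final D'"]) (auto simp: Dec add_mset_commute)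
    qed
  next
    case (IsZero c)
    have "step P (add_mset (Active l) (add_mset Guard D)) (add_mset (Active m) (add_mset Guard D))"
      if "tokens D = s" for D
      by (rule step_non_blockingI[where m = "MZero c"])
        (use i that in \<open>auto simp: IsZero in_trans simp flip: tokens_eq_0_iff\<close>)
    then show ?thesis using i by (intro exI[of _ k]) (auto simp: IsZero intro: r_into_rtranclp)
  next
    case Skip
    have "step P (add_mset (Active l) (add_mset Guard D)) (add_mset (Active m) (add_mset Guard D))" for D
      by (rule step_internalI) (use i in \<open>auto simp: Skip in_trans\<close>)
    then show ?thesis using i by (intro exI[of _ k]) (auto simp: Skip intro: r_into_rtranclp)
  qed
  then show ?case using IH by (meson rtranclp_trans)
qed

lemma synchro_if_reach:
  assumes "reach 1 (\<lambda>_. 0)"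
  shows "\<exists>k j. (step P)\<^sup>*\<^sup>* (replicate_mset (Suc k) Start) (replicate_mset (Suc j) Final)"
proof -
  from simulate_run[OF assms[unfolded reach_def]] obtain k where
    k: "\<And>D. set_mset D \<subseteq> {Idle, Final} \<union> range Token \<Longrightarrow> count D Idle = k \<Longrightarrow> tokens D = (\<lambda>_. 0) \<Longrightarrow>
      \<exists>j. (step P)\<^sup>*\<^sup>* (add_mset (Active l0) (add_mset Guard D))
        (add_mset (Active 1) (add_mset Guard (replicate_mset j Final)))"
    by blast
  let ?D = "replicate_mset k Idle"
  have "set_mset ?D \<subseteq> {Idle, Final} \<union> range Token" "count ?D Idle = k" "tokens ?D = (\<lambda>_. 0)"
    by (auto simp: tokens_def split: if_splits)
  from k[OF this] obtain j where
    run: "(step P)\<^sup>*\<^sup>* (add_mset (Active l0) (add_mset Guard ?D))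
      (add_mset (Active 1) (add_mset Guard (replicate_mset j Final)))"
    by blast
  \<comment> \<open>Beyond the \<open>k\<close> idle processes two more are required, a candidate
    and a guard. \<open>Lead\<close> is sent first, while every process is in \<open>Start\<close>
    and nobody can hear it.\<close>
  have "step P (add_mset Start (add_mset Start (replicate_mset k Start)))
      (add_mset Candidate (add_mset Start (replicate_mset k Start)))"
    by (rule step_non_blockingI[where m = Lead]) (auto simp: in_trans split: if_splits)
  moreover have "(step P)\<^sup>*\<^sup>* (D + replicate_mset n Start) (D + replicate_mset n Idle)" for n D
  proof (induction n arbitrary: D)
    case (Suc n)
    have "step P (add_mset Start (D + replicate_mset n Start)) (add_mset Idle (D + replicate_mset n Start))"
      by (rule step_internalI) (simp add: in_trans)
    with Suc[of "add_mset Idle D"] show ?case by (simp add: converse_rtranclp_into_rtranclp)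
  qed simp
  from this[of "{#Candidate, Start#}" k]
  have "(step P)\<^sup>*\<^sup>* (add_mset Candidate (add_mset Start (replicate_mset k Start)))
      (add_mset Start (add_mset Candidate ?D))"
    by (simp add: add_mset_commute)
  moreover have "step P (add_mset Start (add_mset Candidate ?D)) (add_mset Guard (add_mset (Active l0) ?D))"
    by (rule step_rendez_vousI[where m = Go]) (auto simp: in_trans)
  moreover have "step P (add_mset (Active 1) (add_mset Guard (replicate_mset j Final)))
      (add_mset Final (add_mset Final (replicate_mset j Final)))"
    by (rule step_rendez_vousI[where m = Finish]) (auto simp: in_trans)
  ultimately have "(step P)\<^sup>*\<^sup>* (replicate_mset (Suc (Suc k)) Start) (replicate_mset (Suc (Suc j)) Final)"
    using run unfolding replicate_mset_Suc add_mset_commute[of Guard]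
    by (meson converse_rtranclp_into_rtranclp rtranclp.rtrancl_into_rtrancl rtranclp_trans)
  then show ?thesis by blast
qed

lemma synchro_machine_protocol:
  assumes "\<And>s. reach 1 s \<Longrightarrow> s = (\<lambda>_. 0)"
  shows "synchro P \<longleftrightarrow> reach 1 (\<lambda>_. 0)"
  using reach_if_synchro synchro_if_reach assms
  by (subst synchro_iff) (auto simp: machine_protocol_def simp del: replicate_mset_Suc)

end

section \<open>Coding and diagonalization\<close>

fun state_code :: "st \<Rightarrow> nat" where
  "state_code Start = 0"
| "state_code Final = 1"
| "state_code Candidate = 2"
| "state_code Guard = 3"
| "state_code Idle = 4"
| "state_code Sink = 5"
| "state_code (Active l) = 5 * l + 6"
| "state_code (Waiting l) = 5 * l + 7"
| "state_code (Token i) = 5 * i + 8"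
| "state_code (Up i) = 5 * i + 9"
| "state_code (Down i) = 5 * i + 10"

fun msg_code :: "msg \<Rightarrow> nat" where
  "msg_code Lead = 0"
| "msg_code Go = 1"
| "msg_code Finish = 2"
| "msg_code Ack = 3"
| "msg_code (MInc i) = 3 * i + 4"
| "msg_code (MDec i) = 3 * i + 5"
| "msg_code (MZero i) = 3 * i + 6"

lemma inj_state_code: "inj state_code"
proof (rule injI)
  fix x y assume "state_code x = state_code y"
  then show "x = y" by (cases x; cases y) (simp; presburger)+
qed

lemma inj_msg_code: "inj msg_code"
proof (rule injI)
  fix x y assume "msg_code x = msg_code y"
  then show "x = y" by (cases x; cases y) (simp; presburger)+
qed

definition nat_trans :: "transition \<Rightarrow> nat \<times> nat action \<times> nat" where
  "nat_trans = (\<lambda>(q, a, q'). (state_code q, map_action msg_code a, state_code q'))"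

lemma inj_nat_trans: "inj nat_trans"
  using inj_eq[OF inj_state_code] inj_eq[OF action.inj_map[OF inj_msg_code]]
  by (auto simp: inj_def nat_trans_def)

definition trans_code :: "transition \<Rightarrow> nat" where
  "trans_code x = transition_code (nat_trans x)"

lemma inj_trans_code: "inj trans_code"
  using inj_eq[OF inj_nat_trans] inj_eq[OF inj_transition_code]
  by (auto simp: inj_def trans_code_def)

lemma trans_code_ge:
  "state_code q \<le> trans_code (q, a, q')"
  "state_code q' \<le> trans_code (q, a, q')"
  "a = Send m \<or> a = Recv m \<Longrightarrow> msg_code m \<le> trans_code (q, a, q')"
proof -
  let ?b = "action_code (map_action msg_code a)"
  have c: "trans_code (q, a, q') = prod_encode (state_code q, prod_encode (?b, state_code q'))"
    by (simp add: trans_code_def nat_trans_def transition_code_def)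
  show "state_code q \<le> trans_code (q, a, q')" by (simp add: c le_prod_encode_1)
  have "prod_encode (?b, state_code q') \<le> trans_code (q, a, q')" by (simp add: c le_prod_encode_2)
  then show "state_code q' \<le> trans_code (q, a, q')"
    using le_prod_encode_2 order_trans by blast
  have "?b \<le> trans_code (q, a, q')"
    using \<open>prod_encode (?b, state_code q') \<le> _\<close> le_prod_encode_1 order_trans by blast
  then show "msg_code m \<le> trans_code (q, a, q')" if "a = Send m \<or> a = Recv m"
    using that by auto
qed

text \<open>A bit pattern exceeds each of its positions, because \<open>x < 2 ^ x\<close>. As
  pairing dominates its components, the code of a transition set exceeds all state and message codes
  in it.\<close>

lemma trans_code_less_set_encode:
  assumes "finite T" "x \<in> T"
  shows "trans_code x < set_encode (trans_code ` T)"
proof -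
  have "trans_code x < 2 ^ trans_code x" by (rule less_exp)
  also have "\<dots> \<le> set_encode (trans_code ` T)"
    unfolding set_encode_def using assms by (intro member_le_sum) auto
  finally show ?thesis .
qed

section \<open>The code of the loader\<close>

definition load_trans :: "nat \<Rightarrow> transition set" where
  "load_trans n = insert (Candidate, Recv Go, Active (2 * n)) (\<Union> (edge_trans ` loader n))"

lemma machine_trans_loader:
  "machine_trans r (E \<union> loader n) (2 * n) = (base_trans r \<union> \<Union> (edge_trans ` E)) \<union> load_trans n"
  by (auto simp: machine_trans_def load_trans_def)

definition load_code :: "nat \<Rightarrow> nat" where
  "load_code n = 2 ^ trans_code (Candidate, Recv Go, Active (2 * n)) +
    (2 ^ trans_code (Active n, Tau, Active 0) +
    ((\<Sum>k<n. 2 ^ trans_code (Active (Suc (n + k)), Send (MInc 0), Waiting (n + k))) +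
     (\<Sum>k<n. 2 ^ trans_code (Waiting (n + k), Recv Ack, Active (n + k)))))"

lemma load_trans_eq:
  "load_trans n = insert (Candidate, Recv Go, Active (2 * n)) (insert (Active n, Tau, Active 0)
    ((\<lambda>k. (Active (Suc (n + k)), Send (MInc 0), Waiting (n + k))) ` {..<n} \<union>
     (\<lambda>k. (Waiting (n + k), Recv Ack, Active (n + k))) ` {..<n}))"
  by (auto simp: load_trans_def loader_def)

lemma set_encode_trans_code: "set_encode (trans_code ` T) = (\<Sum>x\<in>T. 2 ^ trans_code x)"
  unfolding set_encode_def
  by (subst sum.reindex) (auto intro: inj_on_subset[OF inj_trans_code])

lemma set_encode_load_trans: "set_encode (trans_code ` load_trans n) = load_code n"
proof -
  let ?A = "(\<lambda>k. (Active (Suc (n + k)), Send (MInc 0), Waiting (n + k))) ` {..<n}"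
  let ?B = "(\<lambda>k. (Waiting (n + k), Recv Ack, Active (n + k))) ` {..<n}"
  have "(\<Sum>x\<in>?A \<union> ?B. 2 ^ trans_code x) = (\<Sum>x\<in>?A. 2 ^ trans_code x) + (\<Sum>x\<in>?B. 2 ^ trans_code x)"
    by (rule sum.union_disjoint) auto
  also have "(\<Sum>x\<in>?A. 2 ^ trans_code x) =
      (\<Sum>k<n. 2 ^ trans_code (Active (Suc (n + k)), Send (MInc 0), Waiting (n + k)))"
    by (subst sum.reindex) (auto simp: inj_on_def)
  also have "(\<Sum>x\<in>?B. 2 ^ trans_code x) =
      (\<Sum>k<n. 2 ^ trans_code (Waiting (n + k), Recv Ack, Active (n + k)))"
    by (subst sum.reindex) (auto simp: inj_on_def)
  finally show ?thesis
    unfolding set_encode_trans_code load_trans_eq load_code_def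
    by (subst sum.insert, simp, force)+ simp
qed

lemma rec_fn_load_code: "rec_fn 1 (\<lambda>xs. load_code (xs ! 0))"
proof -
  \<comment> \<open>The numerals are evaluated codes: 9 stands for \<open>Send (MInc 0)\<close>, 8
    for \<open>Recv Ack\<close>, 4 for \<open>Recv Go\<close>, 2 for \<open>Candidate\<close>.
    \<open>Active m\<close> and \<open>Waiting m\<close> are \<open>5 * m + 6\<close> and
    \<open>5 * m + 7\<close>, so 11 belongs to \<open>Active (Suc m)\<close>. In
    \<open>k # xs\<close> position 1 is \<open>n\<close>.\<close>
  have "rec_fn 1 (\<lambda>xs. \<Sum>k<xs ! 0. 2 ^ prod_encode (5 * ((k # xs) ! 1 + (k # xs) ! 0) + 11,
      prod_encode (9, 5 * ((k # xs) ! 1 + (k # xs) ! 0) + 7)))"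
    by (intro rec_fn_sum rec_fn_power2 rec_fn_prod_encode rec_fn_add rec_fn_mult rec_fn_const rec_fn_proj)
      simp_all
  moreover have "rec_fn 1 (\<lambda>xs. \<Sum>k<xs ! 0. 2 ^ prod_encode (5 * ((k # xs) ! 1 + (k # xs) ! 0) + 7,
      prod_encode (8, 5 * ((k # xs) ! 1 + (k # xs) ! 0) + 6)))"
    by (intro rec_fn_sum rec_fn_power2 rec_fn_prod_encode rec_fn_add rec_fn_mult rec_fn_const rec_fn_proj)
      simp_all
  moreover have "rec_fn 1 (\<lambda>xs. 2 ^ prod_encode (2, prod_encode (4, 5 * (2 * xs ! 0) + 6)))"
    "rec_fn 1 (\<lambda>xs. 2 ^ prod_encode (5 * xs ! 0 + 6, prod_encode (0, 6)))"
    by (intro rec_fn_power2 rec_fn_prod_encode rec_fn_add rec_fn_mult rec_fn_const rec_fn_proj; simp)+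
  ultimately have "rec_fn 1 (\<lambda>xs. 2 ^ prod_encode (2, prod_encode (4, 5 * (2 * xs ! 0) + 6)) +
    (2 ^ prod_encode (5 * xs ! 0 + 6, prod_encode (0, 6)) +
    ((\<Sum>k<xs ! 0. 2 ^ prod_encode (5 * ((k # xs) ! 1 + (k # xs) ! 0) + 11,
      prod_encode (9, 5 * ((k # xs) ! 1 + (k # xs) ! 0) + 7))) +
     (\<Sum>k<xs ! 0. 2 ^ prod_encode (5 * ((k # xs) ! 1 + (k # xs) ! 0) + 7,
      prod_encode (8, 5 * ((k # xs) ! 1 + (k # xs) ! 0) + 6))))))"
    by (intro rec_fn_add)
  then show ?thesis
    by (rule rec_fn_cong)
      (simp add: load_code_def trans_code_def nat_trans_def transition_code_def add.commute)
qed

text \<open>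
  If \<open>n\<close> codes the transitions of a machine without loader, then \<open>n\<close> exceeds all its labels, so the
  labels from \<open>n\<close> on are free for the loader and the codes of the two transition sets just add up.
\<close>
definition loaded_code :: "nat \<Rightarrow> nat" where
  "loaded_code n = prod_encode (\<Sum>k<10 * n + 20. 2 ^ k, prod_encode (\<Sum>k<10 * n + 20. 2 ^ k,
    prod_encode (0, prod_encode (1, n + load_code n))))"

lemma rec_fn_loaded_code: "rec_fn 1 (\<lambda>xs. loaded_code (xs ! 0))"
proof -
  have "rec_fn 1 (\<lambda>xs. \<Sum>k<10 * xs ! 0 + 20. 2 ^ ((k # xs) ! 0))"
    by (intro rec_fn_sum rec_fn_power2 rec_fn_add rec_fn_mult rec_fn_const rec_fn_proj) simp_all
  then have "rec_fn 1 (\<lambda>xs. \<Sum>k<10 * xs ! 0 + 20. 2 ^ k)" by simp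
  then show ?thesis unfolding loaded_code_def
    by (intro rec_fn_prod_encode rec_fn_add rec_fn_const rec_fn_load_code rec_fn_proj) simp_all
qed

section \<open>Loaded protocols\<close>

fun is_waiting :: "st \<Rightarrow> bool" where
  "is_waiting Start = False"
| "is_waiting (Active l) = False"
| "is_waiting (Up i) = False"
| "is_waiting (Down i) = False"
| "is_waiting _ = True"

lemma machine_trans_wait_only:
  assumes "(q, a, q') \<in> machine_trans r E l0"
  shows "is_waiting q \<longleftrightarrow> (\<exists>m. a = Recv m)"
proof -
  have "is_waiting q \<longleftrightarrow> (\<exists>m. a = Recv m)" if "(q, a, q') \<in> edge_trans e" for e
    using that by (cases e rule: edge_trans.cases) auto
  with assms show ?thesis
    by (auto simp: machine_trans_def base_trans_def)
qed

definition loaded_protocol :: "nat \<Rightarrow> edge set \<Rightarrow> nat \<Rightarrow> (nat, nat) protocol" where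
  "loaded_protocol r E n =
    \<lparr>states = {..<10 * n + 20}, alphabet = {..<10 * n + 20}, q_init = 0, q_final = 1,
     trans = nat_trans ` machine_trans r (E \<union> loader n) (2 * n)\<rparr>"

lemma wait_only_loaded_protocol: "wait_only (loaded_protocol r E n)"
  unfolding wait_only_def
proof (intro exI conjI allI impI)
  let ?S = "states (loaded_protocol r E n)" and ?W = "state_code ` Collect is_waiting"
  show "(?S - ?W) \<union> (?S \<inter> ?W) = ?S" "(?S - ?W) \<inter> (?S \<inter> ?W) = {}" by auto
  have "state_code q \<in> ?W \<longleftrightarrow> is_waiting q" for q
    using inj_image_mem_iff[OF inj_state_code] by auto
  then have *: "x \<in> ?W \<longleftrightarrow> (\<exists>m. a = Recv m)"
    if "(x, a, y) \<in> trans (loaded_protocol r E n)" for x a y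
    using that machine_trans_wait_only
    by (auto simp: loaded_protocol_def nat_trans_def) (metis action.exhaust action.simps)+
  have "state_code Start \<notin> ?W"
    using inj_image_mem_iff[OF inj_state_code, of Start] by simp
  then show "q_init (loaded_protocol r E n) \<in> ?S - ?W"
    by (simp add: loaded_protocol_def)
  fix q m q'
  show "q \<notin> ?S - ?W" if "(q, Recv m, q') \<in> trans (loaded_protocol r E n)"
    using *[OF that] by simp
  show "q \<notin> ?S \<inter> ?W" if "(q, Send m, q') \<in> trans (loaded_protocol r E n)"
    using *[OF that] by simp
  show "q \<notin> ?S \<inter> ?W" if "(q, Tau, q') \<in> trans (loaded_protocol r E n)"
    using *[OF that] by simp
qed

lemma synchro_loaded_protocol:
  "synchro (loaded_protocol r E n) \<longleftrightarrow> synchro (machine_protocol r (E \<union> loader n) (2 * n))"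
proof -
  let ?P = "loaded_protocol r E n" and ?M = "machine_protocol r (E \<union> loader n) (2 * n)"
  have "trans ?P = (\<lambda>(q, a, q'). (state_code q, map_action msg_code a, state_code q')) ` trans ?M"
    by (simp add: loaded_protocol_def machine_protocol_def nat_trans_def)
  from steps_image_mset[OF inj_state_code inj_msg_code this]
  have "(step ?P)\<^sup>*\<^sup>* (replicate_mset k 0) (replicate_mset j 1) \<longleftrightarrow>
      (step ?M)\<^sup>*\<^sup>* (replicate_mset k Start) (replicate_mset j Final)" for k j
    by (metis image_replicate_mset state_code.simps(1,2))
  then show ?thesis
    by (subst (1 2) synchro_iff)
      (simp_all add: loaded_protocol_def machine_protocol_def del: replicate_mset_Suc)
qed

context
  fixes r :: nat and E :: "edge set" and n :: nat
  assumes finite_E: "finite E"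
    and n: "n = set_encode (trans_code ` (base_trans r \<union> \<Union> (edge_trans ` E)))"
begin

lemma finite_machine_part: "finite (base_trans r \<union> \<Union> (edge_trans ` E))"
proof -
  have "finite (edge_trans e)" for e by (cases e rule: edge_trans.cases) auto
  then show ?thesis using finite_E by (auto simp: base_trans_def)
qed

lemma trans_code_less: "x \<in> base_trans r \<union> \<Union> (edge_trans ` E) \<Longrightarrow> trans_code x < n"
  unfolding n using trans_code_less_set_encode finite_machine_part by blast

lemma state_code_less:
  assumes "(q, a, q') \<in> base_trans r \<union> \<Union> (edge_trans ` E)"
  shows "state_code q < n" "state_code q' < n"
  using trans_code_less[OF assms] trans_code_ge(1)[of q a q'] trans_code_ge(2)[of q' q a] by auto

lemma one_less: "1 < n"
  using state_code_less[of "Active 1" "Send Finish" Final] by (simp add: base_trans_def)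

lemma labels_less: "(l, i, l') \<in> E \<Longrightarrow> l < n \<and> l' < n"
proof -
  assume e: "(l, i, l') \<in> E"
  have "\<exists>a x. (Active l, a, x) \<in> edge_trans (l, i, l')" "\<exists>a x. (x, a, Active l') \<in> edge_trans (l, i, l')"
    by (cases i; auto)+
  with e have "state_code (Active l) < n" "state_code (Active l') < n"
    using state_code_less by blast+
  then show "l < n \<and> l' < n" by simp
qed

text \<open>Every transition of the loader, including the entry of the leader at
  \<open>Active (2 * n)\<close>, touches a state whose code is at least \<open>n\<close>; the states
  of the other transitions have codes below \<open>n\<close>.\<close>

lemma disjoint_load_trans: "(base_trans r \<union> \<Union> (edge_trans ` E)) \<inter> load_trans n = {}"
proof -
  have "n \<le> state_code q \<or> n \<le> state_code q'" if "(q, a, q') \<in> load_trans n" for q a q'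
    using that by (auto simp: load_trans_eq)
  then show ?thesis using state_code_less by (fastforce simp del: Un_iff)
qed

lemma protocol_code_loaded_protocol: "protocol_code (loaded_protocol r E n) = loaded_code n"
proof -
  let ?T = "base_trans r \<union> \<Union> (edge_trans ` E)"
  have "transition_code ` nat_trans ` (?T \<union> load_trans n) = trans_code ` (?T \<union> load_trans n)"
    by (auto simp: trans_code_def)
  moreover have "set_encode (trans_code ` (?T \<union> load_trans n)) = n + load_code n"
  proof -
    have "finite (load_trans n)" by (simp add: load_trans_eq)
    then have "set_encode (trans_code ` (?T \<union> load_trans n)) =
        set_encode (trans_code ` ?T) + set_encode (trans_code ` load_trans n)"
      unfolding set_encode_trans_code
      by (intro sum.union_disjoint finite_machine_part disjoint_load_trans)
    then show ?thesis by (simp add: set_encode_load_trans n[symmetric])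
  qed
  ultimately show ?thesis
    by (simp add: protocol_code_def loaded_protocol_def machine_trans_loader loaded_code_def
        set_encode_lessThan)
qed

lemma is_protocol_loaded_protocol: "is_protocol (loaded_protocol r E n)"
proof -
  \<comment> \<open>The largest state of the loader is \<open>Active (2 * n)\<close> with code
    \<open>10 * n + 6\<close>, and the codes in the other transitions are below \<open>n\<close>; 20
    leaves room for the constant codes. An initial segment as state set has a bounded sum as its
    code.\<close>
  let ?N = "10 * n + 20"
  have T: "state_code q < ?N \<and> state_code q' < ?N \<and> (\<forall>m. a = Send m \<or> a = Recv m \<longrightarrow> msg_code m < ?N)"
    if "(q, a, q') \<in> machine_trans r (E \<union> loader n) (2 * n)" for q a q'
    using that unfolding machine_trans_loader
  proof
    assume x: "(q, a, q') \<in> base_trans r \<union> \<Union> (edge_trans ` E)"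
    then show ?thesis
      using state_code_less[OF x] trans_code_less[OF x] trans_code_ge(3)[of a _ q q'] by fastforce
  next
    assume "(q, a, q') \<in> load_trans n"
    then show ?thesis by (auto simp: load_trans_eq)
  qed
  have "nat_trans x \<in> {..<?N} \<times> ({Tau} \<union> Recv ` {..<?N} \<union> Send ` {..<?N}) \<times> {..<?N}"
    if "x \<in> machine_trans r (E \<union> loader n) (2 * n)" for x
  proof -
    obtain q a q' where "x = (q, a, q')" by (cases x)
    with T[of q a q'] that show ?thesis by (cases a) (auto simp: nat_trans_def)
  qed
  then have "nat_trans ` machine_trans r (E \<union> loader n) (2 * n) \<subseteq>
      {..<?N} \<times> ({Tau} \<union> Recv ` {..<?N} \<union> Send ` {..<?N}) \<times> {..<?N}"
    by (rule image_subsetI)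
  then show ?thesis by (simp add: is_protocol_def loaded_protocol_def)
qed

end

section \<open>The diagonal argument\<close>

lemma decidable_subset: "decidable code I A \<Longrightarrow> J \<subseteq> I \<Longrightarrow> decidable code J A"
  unfolding decidable_def by blast

lemma wait_only_undecidable:
  "\<not> decidable protocol_code {P. is_protocol P \<and> wait_only P} synchro"
proof
  assume "decidable protocol_code {P. is_protocol P \<and> wait_only P} synchro"
  then obtain d where d: "\<And>P. is_protocol P \<Longrightarrow> wait_only P \<Longrightarrow>
      computes d [protocol_code P] (if synchro P then 1 else 0)"
    by (auto simp: decidable_def)
  obtain c where c: "\<And>n. computes c [n] (loaded_code n)"
    using rec_fn_loaded_code unfolding rec_fn_def by (metis One_nat_def length_Cons list.size(3) nth_Cons_0)
  obtain E where E: "finite E" "\<And>n s. \<forall>(p, i, q)\<in>E. p < n \<and> q < n \<Longrightarrow> 1 < n \<Longrightarrow>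
      (mstep (E \<union> loader n))\<^sup>*\<^sup>* (2 * n, \<lambda>_. 0) (1, s) \<longleftrightarrow> computes (Comp d [c]) [n] 0 \<and> s = (\<lambda>_. 0)"
    using acceptor_machine[of "Comp d [c]"] by blast
  \<comment> \<open>Register 0 is included because the loader increments it.\<close>
  have "finite (insert 0 (\<Union>(l, i, l')\<in>E. register i))"
  proof -
    have "finite (register i)" for i by (cases i) auto
    with E(1) show ?thesis by auto
  qed
  then obtain r where r: "\<And>j. j \<in> insert 0 (\<Union>(l, i, l')\<in>E. register i) \<Longrightarrow> j < r"
    unfolding finite_nat_set_iff_bounded by blast
  \<comment> \<open>Not circular: \<open>E\<close> and \<open>r\<close> have been fixed without
    reference to \<open>n\<close>, and the loader for \<open>n\<close> is not among the transitions
    coded here.\<close>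
  define n where "n = set_encode (trans_code ` (base_trans r \<union> \<Union> (edge_trans ` E)))"
  let ?P = "loaded_protocol r E n"
  interpret machine r "E \<union> loader n" "2 * n"
  proof
    fix l i l' assume "(l, i, l') \<in> E \<union> loader n"
    then have "register i \<subseteq> insert 0 (\<Union>(l, i, l')\<in>E. register i)" by (auto simp: loader_def)
    with r show "register i \<subseteq> {..<r}" by blast
  qed
  have "\<forall>(p, i, q)\<in>E. p < n \<and> q < n" "1 < n"
    using labels_less[OF E(1) n_def] one_less[OF E(1) n_def] by auto
  from E(2)[OF this] have acc: "reach 1 s \<longleftrightarrow> computes (Comp d [c]) [n] 0 \<and> s = (\<lambda>_. 0)" for s
    by (simp add: reach_def)
  then have "synchro ?P \<longleftrightarrow> computes (Comp d [c]) [n] 0"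
    unfolding synchro_loaded_protocol by (subst synchro_machine_protocol) auto
  also have "\<dots> \<longleftrightarrow> \<not> synchro ?P"
  proof -
    have "computes d [loaded_code n] (if synchro ?P then 1 else 0)"
      using d[of ?P] is_protocol_loaded_protocol[OF E(1) n_def] wait_only_loaded_protocol
        protocol_code_loaded_protocol[OF E(1) n_def] by auto
    then have "computes (Comp d [c]) [n] (if synchro ?P then 1 else 0)"
      using c[of n] by (intro computes.Comp[where ys = "[loaded_code n]"]) auto
    then show ?thesis
      using computes_deterministic by (auto split: if_splits)
  qed
  finally show False by blast
qed

theorem theorem7:
  shows "\<not> decidable protocol_code {P. is_protocol P} synchro
    \<and> \<not> decidable protocol_code {P. is_protocol P \<and> wait_only P} synchro"
proof
  have "{P. is_protocol P \<and> wait_only P} \<subseteq> {P :: (nat, nat) protocol. is_protocol P}" by blast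
  then show "\<not> decidable protocol_code {P. is_protocol P} synchro"
    using wait_only_undecidable decidable_subset by metis
qed (rule wait_only_undecidable)

end
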